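(* Let $\tau,\tau_{ij}$ ($i,j=1,\dots,N$) be $\tau$-functions of the $N$-component BKP hierarchy, with Baker matrix $\psi(z,\boldsymbol t)$ and coefficient matrix $\beta(\boldsymbol t)=(\beta_{ij}(\boldsymbol t))$ as defined in the context. Assume that the Baker matrix is meromorphic in $z$ inside the unit circle, with poles at points $z_1,\dots,z_n$ different from $0$, and set $G(\boldsymbol t):=\psi(0,\boldsymbol t)$. Let $\boldsymbol\psi_i(z,\boldsymbol t)$ and $\boldsymbol g_i(\boldsymbol t)$ denote the $i$-th rows of the matrices $\psi(z,\boldsymbol t)$ and $G(\boldsymbol t)$, and let $u_i:=t_{i,1}$. Then: 1. The vectors $\boldsymbol\psi_i(z,\boldsymbol t)$ satisfy $$\frac{\partial\boldsymbol\psi_i}{\partial u_j}-\beta_{ij}\boldsymbol\psi_j=0,\qquad i,j=1,\dots,N,\ i\ne j.$$ 2. The vectors $\boldsymbol g_i(\boldsymbol t)$ satisfy $$\frac{\partial\boldsymbol g_i}{\partial u_j}-\beta_{ij}\boldsymbol g_j=0,\quad i,j=1,\dots,N,\ i\neq j,$$ $$\frac{\partial\boldsymbol g_i}{\partial u_i}+\sum_{\substack{k=1,\dots,N\\ k\ne i}}\beta_{ki}\boldsymbol g_k=0,\quad i=1,\dots,N.$$ 3. The coefficients $\beta_{ij}$ are solutions of the Lamé equations: $$\frac{\partial\beta_{ij}}{\partial u_k}-\beta_{ik}\beta_{kj}=0,\qquad i,j,k=1,\dots,N,\ \text{with } i,j,k \text{ different},$$ $$\frac{\partial\beta_{ij}}{\partial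 u_i}+\frac{\partial\beta_{ji}}{\partial u_j}+\sum_{\substack{k=1,\dots,N\\ k\ne i,j}}\beta_{ki}\beta_{kj}=0,\qquad i,j=1,\dots,N,\ i\ne j.$$
   Context: **Times.** Times are $\boldsymbol t=(\boldsymbol t_1,\dots,\boldsymbol t_N)$ with $\boldsymbol t_i=(t_{i,1},t_{i,3},t_{i,5},\dots)\in\mathbb C^\infty$. Put $\xi(z,\boldsymbol t_i):=\sum_{n\ge 0}z^{2n+1}t_{i,2n+1}$ and $[1/z]:=2\big(\tfrac1z,\tfrac1{3z^3},\tfrac1{5z^5},\dots\big)$. The time $\boldsymbol t\pm[1/z]\boldsymbol e_j$ is obtained from $\boldsymbol t$ by replacing $\boldsymbol t_j$ by $\boldsymbol t_j\pm[1/z]$. **$\tau$-functions.** The $\tau$-functions of the $N$-component BKP hierarchy are functions $\tau(\boldsymbol t),\tau_{ij}(\boldsymbol t)$ (arising as vacuum expectation values in a theory of $N$ free neutral Ramond fermions) with $\tau_{ij}+\tau_{ji}=0$ for $i\ne j$ and $2\tau_{ii}=\tau$ for all $i$, which satisfy the bilinear equation defining the hierarchy: for suitable $\boldsymbol t,\boldsymbol t'$ and all $i,j=1,\dots,N$, $$\sum_{k=1}^N\int_{S^1}\frac{\mathrm dz}{2\pi \mathrm i z}\,e^{\xi(z,\boldsymbol t_k)-\xi(z,\boldsymbol t'_k)}\,\tau_{ik}(\boldsymbol t-[1/z]\boldsymbol e_k)\,\tau_{jk}(\boldsymbol t'+[1/z]\boldsymbol e_k)=\sum_{k=1}^N\tau_{ki}(\boldsymbol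 t)\tau_{kj}(\boldsymbol t'),$$ where $S^1=\{z\in\mathbb C:|z|=1\}$. Throughout, $\boldsymbol t$ and $\boldsymbol t'$ range over suitable times, i.e. times for which the expressions involved make sense. **Baker matrix.** The superscript $\mathrm t$ denotes the transpose. Let $\mathcal T(\boldsymbol t):=(\tau_{ij}(\boldsymbol t))$, taken to be invertible, $\psi_0(z,\boldsymbol t):=\operatorname{diag}(e^{\xi(z,\boldsymbol t_1)},\dots,e^{\xi(z,\boldsymbol t_N)})$, and $\varphi_{ij}(z,\boldsymbol t):=\tau_{ij}(\boldsymbol t-[1/z]\boldsymbol e_j)\,e^{\xi(z,\boldsymbol t_j)}$. The Baker matrix is $\psi(z,\boldsymbol t):=\mathcal T^{-1}(\boldsymbol t)\varphi(z,\boldsymbol t)$. It has the form $\psi=\chi\psi_0$ with the asymptotic expansion $\chi(z,\boldsymbol t)\sim 1+\beta(\boldsymbol t)z^{-1}+O(z^{-2})$ as $z\to\infty$, which defines $\beta(\boldsymbol t)=(\beta_{ij}(\boldsymbol t))$. **The matrix $G$.** The bilinear equation can be written as $$\int_{S^1}\frac{\mathrm dz}{2\pi \mathrm i z}\,\psi(z,\boldsymbol t)\,\psi^{\mathrm t}(-z,\boldsymbol t')=G(\boldsymbol t)\,G^{\mathrm t}(\boldsymbol t'),$$ with $G=\mathcal T^{-1}\mathcal T^{\mathrm t}$; in particular $G$ is an orthogonal matrix. This relation determines $G$ only up to $G\to GC$ with $C$ a constant orthogonal matrix. When $\psi$ is meromorphic inside the unit circle as assumed in the claim, $\psi(0,\boldsymbol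 t)\psi^{\mathrm t}(0,\boldsymbol t')=G(\boldsymbol t)G^{\mathrm t}(\boldsymbol t')$, so that one may choose, as is done in the claim, $G(\boldsymbol t)=\psi(0,\boldsymbol t)$.
   Formalization: Part 2 additionally assumes ψ(0,t)ψᵗ(0,t') = G₀(t)G₀ᵗ(t') with G₀ = T⁻¹Tᵗ; meromorphy alone does not give it: for N=1, τ=1+c·exp ξ(p,t), 0<|p|<1, ψ(0,t) is not constant in u₁. *)

theory Defs
  imports "HOL-Complex_Analysis.Complex_Analysis" "HOL-Library.Landau_Symbols"
begin

(* "$" is used for components of vectors and matrices only *)
no_notation fps_nth (infixl \<open>$\<close> 75)

text \<open>
  The components are indexed by a finite type \<open>'n\<close>, so \<open>N = CARD('n)\<close>.  Only odd times occur:
  \<open>t i n\<close> stands for \<open>t_{i,2n+1}\<close>; in particular \<open>u_i = t_{i,1}\<close> is \<open>t i 0\<close>.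
\<close>

type_synonym 'n bkp_times = "'n \<Rightarrow> nat \<Rightarrow> complex"

definition xi :: "complex \<Rightarrow> (nat \<Rightarrow> complex) \<Rightarrow> complex" where
  "xi z a = (\<Sum>n. z ^ (2 * n + 1) * a n)"

text \<open>
  \<open>bracket w\<close> is the sequence \<open>2 (w, w^3/3, w^5/5, ...)\<close>, so that \<open>bracket (1/z)\<close> is \<open>[1/z]\<close>
  and \<open>bracket 0 = 0\<close> is its limit as \<open>z\<close> tends to infinity.
\<close>

definition bracket :: "complex \<Rightarrow> nat \<Rightarrow> complex" where
  "bracket w = (\<lambda>n. 2 * w ^ (2 * n + 1) / of_nat (2 * n + 1))"

definition time_plus :: "'n bkp_times \<Rightarrow> (nat \<Rightarrow> complex) \<Rightarrow> 'n \<Rightarrow> 'n bkp_times" where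
  "time_plus t a j = t(j := (\<lambda>n. t j n + a n))"

definition time_minus :: "'n bkp_times \<Rightarrow> (nat \<Rightarrow> complex) \<Rightarrow> 'n \<Rightarrow> 'n bkp_times" where
  "time_minus t a j = t(j := (\<lambda>n. t j n - a n))"

definition u_shift :: "complex ^ ('n::finite) \<Rightarrow> 'n bkp_times \<Rightarrow> 'n bkp_times" where
  "u_shift s t = (\<lambda>i n. if n = 0 then t i 0 + s $ i else t i n)"


subsection \<open>Partial derivatives with respect to \<open>u_j\<close>\<close>

definition u_differentiable :: "'n::finite \<Rightarrow> ('n bkp_times \<Rightarrow> complex) \<Rightarrow> 'n bkp_times \<Rightarrow> bool" where
  "u_differentiable j F t \<longleftrightarrow> (\<lambda>w. F (u_shift (axis j w) t)) field_differentiable (at 0)"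

definition u_deriv :: "'n::finite \<Rightarrow> ('n bkp_times \<Rightarrow> complex) \<Rightarrow> 'n bkp_times \<Rightarrow> complex" where
  "u_deriv j F t = deriv (\<lambda>w. F (u_shift (axis j w) t)) 0"

definition u_differentiable_vec ::
  "'n::finite \<Rightarrow> ('n bkp_times \<Rightarrow> complex ^ 'm) \<Rightarrow> 'n bkp_times \<Rightarrow> bool" where
  "u_differentiable_vec j F t \<longleftrightarrow> (\<forall>l. u_differentiable j (\<lambda>t. F t $ l) t)"

definition u_deriv_vec ::
  "'n::finite \<Rightarrow> ('n bkp_times \<Rightarrow> complex ^ 'm) \<Rightarrow> 'n bkp_times \<Rightarrow> complex ^ 'm" where
  "u_deriv_vec j F t = (\<chi> l. u_deriv j (\<lambda>t. F t $ l) t)"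


subsection \<open>Suitable times\<close>

text \<open>
  The times at which the expressions below make sense: \<open>\<xi>(z, t_i)\<close> converges for every \<open>z\<close>,
  small changes of the \<open>u_i\<close> remain suitable, and \<open>\<tau>_{ij}(t - [1/z] e_j)\<close> is holomorphic in
  \<open>1/z\<close> for \<open>|z| > 1\<close> (including infinity), holomorphic in \<open>u_1, ..., u_N\<close>, and jointly continuous
  up to \<open>|z| = 1\<close>.  The variable \<open>w\<close> below is \<open>1/z\<close>; replacing \<open>w\<close> by \<open>-w\<close> covers
  \<open>t + [1/z] e_j\<close>.
\<close>

definition suitable_times ::
  "('n::finite bkp_times) set \<Rightarrow> ('n \<Rightarrow> 'n \<Rightarrow> 'n bkp_times \<Rightarrow> complex) \<Rightarrow> bool" where
  "suitable_times S \<tau> \<longleftrightarrow>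
     (\<forall>t\<in>S. (\<forall>i z. summable (\<lambda>n. z ^ (2 * n + 1) * t i n)) \<and>
       (\<exists>r>0. (\<forall>s \<in> ball 0 r. u_shift s t \<in> S) \<and>
         (\<forall>i j. let F = (\<lambda>w s. \<tau> i j (time_minus (u_shift s t) (bracket w) j)) in
            continuous_on (cball 0 1 \<times> ball 0 r) (\<lambda>(w, s). F w s) \<and>
            (\<forall>s \<in> ball 0 r. (\<lambda>w. F w s) holomorphic_on ball 0 1) \<and>
            (\<forall>w \<in> cball 0 1. \<forall>s \<in> ball 0 r. \<forall>k.
               (\<lambda>x. F w (s + axis k x)) field_differentiable (at 0)))))"


subsection \<open>\<open>\<tau>\<close>-functions and the Baker matrix\<close>

definition bkp_tau_functions ::
  "('n::finite bkp_times) set \<Rightarrow> ('n bkp_times \<Rightarrow> complex) \<Rightarrow>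
   ('n \<Rightarrow> 'n \<Rightarrow> 'n bkp_times \<Rightarrow> complex) \<Rightarrow> bool" where
  "bkp_tau_functions S \<tau>0 \<tau> \<longleftrightarrow>
     (\<forall>t\<in>S. (\<forall>i j. i \<noteq> j \<longrightarrow> \<tau> i j t + \<tau> j i t = 0) \<and> (\<forall>i. 2 * \<tau> i i t = \<tau>0 t)) \<and>
     (\<forall>t\<in>S. \<forall>t'\<in>S. \<forall>i j.
        (\<Sum>k\<in>UNIV. contour_integral (circlepath 0 1)
           (\<lambda>z. 1 / (2 * of_real pi * \<i> * z) * exp (xi z (t k) - xi z (t' k)) *
                \<tau> i k (time_minus t (bracket (1 / z)) k) *
                \<tau> j k (time_plus t' (bracket (1 / z)) k)))
        = (\<Sum>k\<in>UNIV. \<tau> k i t * \<tau> k j t'))"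

definition tau_matrix ::
  "('n::finite \<Rightarrow> 'n \<Rightarrow> 'n bkp_times \<Rightarrow> complex) \<Rightarrow> 'n bkp_times \<Rightarrow> complex ^ 'n ^ 'n" where
  "tau_matrix \<tau> t = (\<chi> i j. \<tau> i j t)"

definition psi0_matrix :: "complex \<Rightarrow> ('n::finite) bkp_times \<Rightarrow> complex ^ 'n ^ 'n" where
  "psi0_matrix z t = (\<chi> i j. if i = j then exp (xi z (t i)) else 0)"

definition phi_matrix ::
  "('n::finite \<Rightarrow> 'n \<Rightarrow> 'n bkp_times \<Rightarrow> complex) \<Rightarrow> complex \<Rightarrow> 'n bkp_times \<Rightarrow> complex ^ 'n ^ 'n" where
  "phi_matrix \<tau> z t = (\<chi> i j. \<tau> i j (time_minus t (bracket (1 / z)) j) * exp (xi z (t j)))"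

definition baker_matrix ::
  "('n::finite \<Rightarrow> 'n \<Rightarrow> 'n bkp_times \<Rightarrow> complex) \<Rightarrow> complex \<Rightarrow> 'n bkp_times \<Rightarrow> complex ^ 'n ^ 'n" where
  "baker_matrix \<tau> z t = matrix_inv (tau_matrix \<tau> t) ** phi_matrix \<tau> z t"

text \<open>\<open>\<chi>\<close> is the unique matrix with \<open>\<psi> = \<chi> \<psi>_0\<close>; see \<open>baker_eq_chi_psi0\<close>.\<close>

definition chi_matrix ::
  "('n::finite \<Rightarrow> 'n \<Rightarrow> 'n bkp_times \<Rightarrow> complex) \<Rightarrow> complex \<Rightarrow> 'n bkp_times \<Rightarrow> complex ^ 'n ^ 'n" where
  "chi_matrix \<tau> z t = matrix_inv (tau_matrix \<tau> t) **
     (\<chi> i j. \<tau> i j (time_minus t (bracket (1 / z)) j))"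

lemma baker_eq_chi_psi0:
  fixes \<tau> :: "'n::finite \<Rightarrow> 'n \<Rightarrow> 'n bkp_times \<Rightarrow> complex"
  shows "baker_matrix \<tau> z t = chi_matrix \<tau> z t ** psi0_matrix z t"
proof -
  define M :: "complex ^ 'n ^ 'n" where
    "M = (\<chi> i j. \<tau> i j (time_minus t (bracket (1 / z)) j))"
  have "(M ** psi0_matrix z t) $ i $ j = phi_matrix \<tau> z t $ i $ j" for i j
  proof -
    have "(M ** psi0_matrix z t) $ i $ j
        = (\<Sum>k\<in>UNIV. if k = j then M $ i $ k * exp (xi z (t k)) else 0)"
      unfolding matrix_matrix_mult_def psi0_matrix_def vec_lambda_beta
      by (intro sum.cong refl) (simp only: mult_zero_right if_distrib[of "(*) _"])
    also have "\<dots> = M $ i $ j * exp (xi z (t j))"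
      by (subst sum.delta) (simp_all only: finite iso_tuple_UNIV_I if_True)
    finally show ?thesis
      unfolding phi_matrix_def M_def vec_lambda_beta .
  qed
  then have "M ** psi0_matrix z t = phi_matrix \<tau> z t"
    unfolding vec_eq_iff by (intro allI)
  then show ?thesis
    unfolding baker_matrix_def chi_matrix_def M_def[symmetric]
    by (simp only: matrix_mul_assoc[symmetric])
qed

definition beta_coefficient ::
  "('n::finite bkp_times) set \<Rightarrow> ('n \<Rightarrow> 'n \<Rightarrow> 'n bkp_times \<Rightarrow> complex) \<Rightarrow>
   ('n bkp_times \<Rightarrow> complex ^ 'n ^ 'n) \<Rightarrow> bool" where
  "beta_coefficient S \<tau> \<beta> \<longleftrightarrow>
     (\<forall>t\<in>S. \<forall>i j. (\<lambda>z. chi_matrix \<tau> z t $ i $ j - mat 1 $ i $ j - \<beta> t $ i $ j / z)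
        \<in> O[at_infinity](\<lambda>z. 1 / z ^ 2))"

text \<open>
  The formula for the Baker matrix is available for \<open>|z| \<ge> 1\<close>, as \<open>[1/z]\<close> need not be an
  admissible shift for small \<open>z\<close>.  Inside the circle the Baker matrix \<open>\<Psi>\<close> is its meromorphic
  continuation; \<open>Z\<close> is the finite set \<open>{z_1, ..., z_n}\<close> containing its poles.
\<close>

definition baker_meromorphic_inside ::
  "('n::finite bkp_times) set \<Rightarrow> ('n \<Rightarrow> 'n \<Rightarrow> 'n bkp_times \<Rightarrow> complex) \<Rightarrow>
   complex set \<Rightarrow> (complex \<Rightarrow> 'n bkp_times \<Rightarrow> complex ^ 'n ^ 'n) \<Rightarrow> bool" where
  "baker_meromorphic_inside S \<tau> Z \<Psi> \<longleftrightarrow>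
     finite Z \<and> Z \<subseteq> ball 0 1 - {0} \<and>
     (\<forall>t\<in>S. (\<forall>z. norm z \<ge> 1 \<longrightarrow> \<Psi> z t = baker_matrix \<tau> z t) \<and>
       (\<forall>i j. (\<lambda>z. \<Psi> z t $ i $ j) meromorphic_on ball 0 1 \<and>
              (\<lambda>z. \<Psi> z t $ i $ j) holomorphic_on ball 0 1 - Z \<and>
              continuous_on (cball 0 1 - Z) (\<lambda>z. \<Psi> z t $ i $ j)))"

definition G_matrix ::
  "('n::finite \<Rightarrow> 'n \<Rightarrow> 'n bkp_times \<Rightarrow> complex) \<Rightarrow> 'n bkp_times \<Rightarrow> complex ^ 'n ^ 'n" where
  "G_matrix \<tau> t = matrix_inv (tau_matrix \<tau> t) ** transpose (tau_matrix \<tau> t)"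

text \<open>
  The bilinear equation determines \<open>T^{-1} T^t\<close> only through the products \<open>G(t) G^t(t')\<close>.
  A function \<open>G\<close> is an admissible choice if it has the same products.  For \<open>G = \<Psi>(0, _)\<close> this
  says that the poles of \<open>\<Psi>(z, t) \<Psi>^t(-z, t') / z\<close> other than \<open>0\<close> contribute nothing to the
  contour integral; it does not follow from meromorphy alone.  For example, if \<open>N = 1\<close>,
  \<open>0 < |p| < 1\<close> and \<open>\<tau> = 1 + c exp(\<xi>(p, t))\<close>, then \<open>\<Psi>\<close> has the single pole \<open>-p\<close>, but
  \<open>\<Psi>(0, t) = (1 - c exp(\<xi>(p, t))) / (1 + c exp(\<xi>(p, t)))\<close> while \<open>T^{-1} T^t = 1\<close>.
\<close>

definition admissible_G ::
  "('n::finite bkp_times) set \<Rightarrow> ('n \<Rightarrow> 'n \<Rightarrow> 'n bkp_times \<Rightarrow> complex) \<Rightarrow>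
   ('n bkp_times \<Rightarrow> complex ^ 'n ^ 'n) \<Rightarrow> bool" where
  "admissible_G S \<tau> G \<longleftrightarrow>
     (\<forall>t\<in>S. \<forall>t'\<in>S. G t ** transpose (G t') = G_matrix \<tau> t ** transpose (G_matrix \<tau> t'))"

end

theory Submission
  imports Defs
begin

text \<open>
  Put \<open>w = 1/z\<close> and \<open>X = T\<^sup>-\<^sup>1 (\<tau>\<^sub>i\<^sub>j(t - [w]e\<^sub>j))\<close>, which is holomorphic in \<open>|w| < 1\<close> with \<open>X = 1\<close> at \<open>w = 0\<close>
  and derivative \<open>\<beta>\<close> there.  For \<open>i \<noteq> j\<close> the row \<open>v = \<partial>\<psi>\<^sub>i/\<partial>u\<^sub>j - \<beta>\<^sub>i\<^sub>j \<psi>\<^sub>j\<close> is \<open>O(w) \<psi>\<^sub>0\<close>.  The bilinear equation at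
  \<open>t' = t\<close> and the orthogonality of \<open>G = T\<^sup>-\<^sup>1T\<^sup>t\<close> give \<open>\<partial>g\<^sub>i/\<partial>u\<^sub>j = \<beta>\<^sub>i\<^sub>j g\<^sub>j\<close>, so \<open>v\<close> is orthogonal to all
  \<open>\<psi>(-z, t')\<close>.  Taking for \<open>t'\<close> small shifts of a single \<open>u\<^sub>k\<close> kills the coefficients of \<open>v\<close> one after the
  other.  Orthogonality of \<open>G\<close> then gives \<open>\<partial>g\<^sub>i/\<partial>u\<^sub>i\<close>; the first Lame equation is the coefficient of
  \<open>w\<close> in \<open>v = 0\<close>, and the second one compares both sides of the bilinear equation after applying
  \<open>\<partial>/\<partial>u\<^sub>i\<close> to the \<open>i\<close>-th row at \<open>t\<close> and \<open>\<partial>/\<partial>u\<^sub>j\<close> to the \<open>j\<close>-th row at \<open>t' = t\<close>.  The equations for the rows are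
  carried inside the circle by Cauchy's formula, once the poles are cleared by a factor independent of \<open>t\<close>.
\<close>

section \<open>Means over the unit circle\<close>

definition circle_mean :: "(complex \<Rightarrow> complex) \<Rightarrow> complex" where
  "circle_mean f = integral {0..1} (\<lambda>x. f (exp (2 * of_real pi * \<i> * of_real x)))"

lemma circle_mean_cong:
  assumes "\<And>z. norm z = 1 \<Longrightarrow> f z = g z"
  shows "circle_mean f = circle_mean g"
  unfolding circle_mean_def using assms by (intro integral_cong) (auto simp: norm_exp_eq_Re)

lemma continuous_on_circle_param:
  assumes "continuous_on (sphere 0 1) f"
  shows "continuous_on A (\<lambda>x. f (exp (2 * of_real pi * \<i> * complex_of_real x)))"
  by (rule continuous_on_compose2[OF assms]) (auto intro!: continuous_intros simp: norm_exp_eq_Re)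

lemma circle_integrable:
  fixes f :: "complex \<Rightarrow> complex"
  assumes "continuous_on (sphere 0 1) f"
  shows "(\<lambda>x. f (exp (2 * of_real pi * \<i> * complex_of_real x))) integrable_on {0..1}"
  by (intro integrable_continuous_real continuous_on_circle_param assms)

lemma circle_mean_sum:
  assumes "finite A" "\<And>a. a \<in> A \<Longrightarrow> continuous_on (sphere 0 1) (f a)"
  shows "circle_mean (\<lambda>z. \<Sum>a\<in>A. f a z) = (\<Sum>a\<in>A. circle_mean (f a))"
  unfolding circle_mean_def using assms by (intro integral_sum circle_integrable) auto

lemma circle_mean_diff:
  assumes "continuous_on (sphere 0 1) f" "continuous_on (sphere 0 1) g"
  shows "circle_mean (\<lambda>z. f z - g z) = circle_mean f - circle_mean g"
  unfolding circle_mean_def using assms by (intro integral_diff circle_integrable)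

lemma circle_mean_cmult: "circle_mean (\<lambda>z. c * f z) = c * circle_mean f"
  unfolding circle_mean_def by simp

lemma circle_mean_inverse: "circle_mean (\<lambda>z. f (1 / z)) = circle_mean f"
proof -
  have *: "1 / exp (2 * of_real pi * \<i> * complex_of_real x) = exp (2 * of_real pi * \<i> * complex_of_real (1 - x))" for x
  proof -
    have "exp (2 * of_real pi * \<i> * complex_of_real (1 - x)) = exp (2 * of_real pi * \<i> + - (2 * of_real pi * \<i> * complex_of_real x))"
      by (simp add: algebra_simps)
    also have "\<dots> = 1 / exp (2 * of_real pi * \<i> * complex_of_real x)"
      by (subst exp_add) (simp add: exp_minus field_simps)
    finally show ?thesis ..
  qed
  let ?g = "\<lambda>x. f (exp (2 * of_real pi * \<i> * complex_of_real x))"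
  have "circle_mean (\<lambda>z. f (1 / z)) = integral {0..1} (\<lambda>x. ?g (1 - x))"
    unfolding circle_mean_def * ..
  also have "\<dots> = integral {0..1} ?g"
    using Henstock_Kurzweil_Integration.integral_reflect_real[where f = "\<lambda>x. ?g (x + 1)" and a = "-1" and b = 0]
      integral_shift_real_ivl[where f = ?g and a = 0 and b = 1 and c = 1] by (simp add: add.commute)
  finally show ?thesis unfolding circle_mean_def .
qed

lemma circle_mean_norm_le:
  assumes "continuous_on (sphere 0 1) f" "\<And>z. norm z = 1 \<Longrightarrow> norm (f z) \<le> B"
  shows "norm (circle_mean f) \<le> B"
  unfolding circle_mean_def
  using integral_bound[of 0 1 "\<lambda>x. f (exp (2 * of_real pi * \<i> * complex_of_real x))" B]
    continuous_on_circle_param[OF assms(1)] assms(2) by (auto simp: norm_exp_eq_Re)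

lemma circle_mean_uniform_limit:
  assumes lim: "uniform_limit (sphere 0 1) f g F"
    and cont: "\<forall>\<^sub>F n in F. continuous_on (sphere 0 1) (f n)" and F: "F \<noteq> bot"
  shows "((\<lambda>n. circle_mean (f n)) \<longlongrightarrow> circle_mean g) F"
proof -
  have g: "continuous_on (sphere 0 1) g"
    using uniform_limit_theorem[OF cont lim] F by simp
  show ?thesis
  proof (rule tendstoI)
    fix e :: real assume e: "e > 0"
    have "\<forall>\<^sub>F n in F. \<forall>z\<in>sphere 0 1. dist (f n z) (g z) < e / 2"
      using lim half_gt_zero[OF e] unfolding uniform_limit_iff by blast
    then show "\<forall>\<^sub>F n in F. dist (circle_mean (f n)) (circle_mean g) < e"
      using cont
    proof eventually_elim
      case (elim n)
      have "norm (circle_mean (\<lambda>z. f n z - g z)) \<le> e / 2"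
        using elim g by (intro circle_mean_norm_le continuous_intros) (auto simp: dist_norm less_imp_le)
      then show ?case
        using circle_mean_diff[OF elim(2) g] e by (simp add: dist_norm)
    qed
  qed
qed

lemma contour_integral_eq_circle_mean:
  "contour_integral (circlepath 0 1) (\<lambda>z. 1 / (2 * of_real pi * \<i> * z) * f z) = circle_mean f"
  unfolding contour_integral_integral circle_mean_def
  by (rule integral_cong) (simp add: vector_derivative_circlepath, simp add: circlepath)

lemma circle_mean_Cauchy:
  assumes "finite K" "continuous_on (cball 0 1) f"
    and "\<And>x. x \<in> ball 0 1 - K \<Longrightarrow> f field_differentiable at x" and z: "z \<in> ball 0 1 - K"
  shows "circle_mean (\<lambda>w. f w * (w / (w - z))) = f z"
proof -
  have "((\<lambda>w. f w / (w - z)) has_contour_integral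
      (2 * pi * \<i> * winding_number (circlepath 0 1) z * f z)) (circlepath 0 1)"
    using assms by (intro Cauchy_integral_formula_weak[where S = "cball 0 1" and k = K]) auto
  moreover have "winding_number (circlepath 0 1) z = 1"
    using z by (intro winding_number_circlepath) auto
  ultimately have "((\<lambda>w. f w / (w - z)) has_contour_integral 2 * pi * \<i> * f z) (circlepath 0 1)"
    by simp
  from has_contour_integral_lmul[OF this, of "1 / (2 * pi * \<i>)"]
  have "f z = contour_integral (circlepath 0 1) (\<lambda>w. 1 / (2 * pi * \<i>) * (f w / (w - z)))"
    by (simp add: contour_integral_unique)
  also have "\<dots> = contour_integral (circlepath 0 1) (\<lambda>w. 1 / (2 * of_real pi * \<i> * w) * (f w * (w / (w - z))))"
    by (rule contour_integral_eq) auto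
  finally show ?thesis unfolding contour_integral_eq_circle_mean ..
qed

lemma circle_mean_at_zero:
  assumes "finite K" "0 \<notin> K" "continuous_on (cball 0 1) f"
    and "\<And>x. x \<in> ball 0 1 - K \<Longrightarrow> f field_differentiable at x"
  shows "circle_mean f = f 0"
proof -
  have "circle_mean (\<lambda>w. f w * (w / (w - 0))) = f 0"
    using assms by (intro circle_mean_Cauchy) auto
  moreover have "circle_mean (\<lambda>w. f w * (w / (w - 0))) = circle_mean f"
    by (rule circle_mean_cong) auto
  ultimately show ?thesis by simp
qed

lemma circle_mean_holomorphic:
  assumes "continuous_on (cball 0 1) f" "f holomorphic_on ball 0 1"
  shows "circle_mean f = f 0"
  using assms by (intro circle_mean_at_zero[where K = "{}"]) (auto simp: holomorphic_on_open field_differentiable_def)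

lemma compact_continuous_norm_bound:
  fixes f :: "'a::topological_space \<Rightarrow> 'b::real_normed_vector"
  assumes "compact K" "continuous_on K f"
  obtains B where "\<And>x. x \<in> K \<Longrightarrow> norm (f x) \<le> B"
  using compact_imp_bounded[OF compact_continuous_image[OF assms(2,1)]] unfolding bounded_iff by auto

lemma uniform_limit_difference_quotient:
  fixes F :: "'a::topological_space \<Rightarrow> complex \<Rightarrow> complex"
  assumes K: "compact K" and r: "r > 0"
    and cont: "continuous_on (K \<times> ball 0 r) (\<lambda>(w, h). F w h)"
    and hol: "\<And>w. w \<in> K \<Longrightarrow> F w holomorphic_on ball 0 r"
  shows "uniform_limit K (\<lambda>h w. (F w h - F w 0) / h) (\<lambda>w. deriv (F w) 0) (at 0)"
proof -
  have "compact (K \<times> cball (0::complex) (r/2))"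
    by (intro compact_Times K) auto
  moreover have "continuous_on (K \<times> cball 0 (r/2)) (\<lambda>(w, h). F w h)"
    by (rule continuous_on_subset[OF cont]) (use r in auto)
  ultimately obtain B where "\<And>x. x \<in> K \<times> cball 0 (r/2) \<Longrightarrow> norm (case x of (w, h) \<Rightarrow> F w h) \<le> B"
    by (rule compact_continuous_norm_bound) blast
  then have B: "\<And>w h. w \<in> K \<Longrightarrow> norm h \<le> r/2 \<Longrightarrow> norm (F w h) \<le> B"
    by fastforce
  define C where "C = 2 * B / (r/4)^2"
  have est: "norm ((F w h - F w 0) / h - deriv (F w) 0) \<le> C * norm h"
    if w: "w \<in> K" and h: "norm h \<le> r/4" "h \<noteq> 0" for w h
  proof -
    have "norm ((deriv ^^ 0) (F w) h - (\<Sum>i\<le>1. (deriv ^^ i) (F w) 0 * (h - 0) ^ i / fact i))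
       \<le> C * norm (h - 0) ^ Suc 1 / fact 1"
    proof (rule complex_Taylor[where S = "cball 0 (r/4)"])
      show "((deriv ^^ i) (F w) has_field_derivative (deriv ^^ Suc i) (F w) x) (at x within cball 0 (r/4))"
        if "x \<in> cball 0 (r/4)" for i x
      proof -
        have "(deriv ^^ i) (F w) holomorphic_on ball 0 r"
          by (intro holomorphic_higher_deriv hol w) auto
        moreover have "x \<in> ball 0 r" using that r by auto
        ultimately show ?thesis
          by (metis DERIV_subset funpow.simps(2) o_apply holomorphic_derivI open_ball subset_UNIV)
      qed
      show "norm ((deriv ^^ Suc 1) (F w) x) \<le> C" if x: "x \<in> cball 0 (r/4)" for x
      proof -
        have sub: "cball x (r/4) \<subseteq> ball 0 r"
        proof
          fix y assume "y \<in> cball x (r/4)"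
          then show "y \<in> ball 0 r"
            using x r norm_triangle_ineq4[of x "x - y"] by (auto simp: dist_norm)
        qed
        have "norm ((deriv ^^ 2) (F w) x) \<le> fact 2 * B / (r/4)^2"
        proof (rule Cauchy_inequality)
          show "F w holomorphic_on ball x (r/4)"
            using holomorphic_on_subset[OF hol[OF w]] sub by (meson ball_subset_cball order_trans)
          show "continuous_on (cball x (r/4)) (F w)"
            using continuous_on_subset[OF holomorphic_on_imp_continuous_on[OF hol[OF w]] sub] .
          show "norm (F w y) \<le> B" if "norm (x - y) = r/4" for y
            using x that norm_triangle_ineq4[of x "x - y"] by (intro B w) auto
        qed (use r in auto)
        then show ?thesis by (simp add: C_def numeral_2_eq_2)
      qed
    qed (use h r in auto)
    then have *: "norm (F w h - F w 0 - deriv (F w) 0 * h) \<le> C * norm h ^ 2"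
      by (simp add: power2_eq_square algebra_simps)
    have "(F w h - F w 0) / h - deriv (F w) 0 = (F w h - F w 0 - deriv (F w) 0 * h) / h"
      using h(2) by (simp add: field_simps)
    then show ?thesis
      using * h(2) by (simp add: norm_divide divide_le_eq power2_eq_square mult.assoc)
  qed
  show ?thesis
    unfolding uniform_limit_iff
  proof safe
    fix e :: real assume e: "e > 0"
    have lim: "((\<lambda>h::complex. C * norm h) \<longlongrightarrow> C * norm (0::complex)) (at 0)"
      by (intro tendsto_mult tendsto_const tendsto_norm tendsto_ident_at)
    have "\<forall>\<^sub>F h in at (0::complex). C * norm h < e"
      using order_tendstoD(2)[OF lim, of e] e by simp
    moreover have "\<forall>\<^sub>F h in at (0::complex). norm h \<le> r/4"
      unfolding eventually_at using r by (intro exI[of _ "r/4"]) (auto simp: dist_norm)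
    moreover have "\<forall>\<^sub>F h in at (0::complex). h \<noteq> 0"
      by (simp add: eventually_at_filter)
    ultimately show "\<forall>\<^sub>F h in at (0::complex). \<forall>w\<in>K. dist ((F w h - F w 0) / h) (deriv (F w) 0) < e"
      by eventually_elim (auto simp: dist_norm intro: le_less_trans[OF est])
  qed
qed

lemma continuous_on_Times_slice:
  assumes "continuous_on (A \<times> B) (\<lambda>(x, y). F x y)" "y \<in> B"
  shows "continuous_on A (\<lambda>x. F x y)"
proof -
  have "continuous_on A (\<lambda>x. case (x, y) of (x, y) \<Rightarrow> F x y)"
    using assms(2) by (intro continuous_on_compose2[OF assms(1)] continuous_on_Pair continuous_on_id continuous_on_const) auto
  then show ?thesis by simp
qed

lemma has_field_derivative_circle_mean:
  assumes r: "r > 0" and cont: "continuous_on (sphere 0 1 \<times> ball 0 r) (\<lambda>(w, h). F w h)"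
    and hol: "\<And>w. norm w = 1 \<Longrightarrow> F w holomorphic_on ball 0 r"
  shows "((\<lambda>h. circle_mean (\<lambda>w. F w h)) has_field_derivative circle_mean (\<lambda>w. deriv (F w) 0)) (at 0)"
proof -
  have conth: "continuous_on (sphere 0 1) (\<lambda>w. F w h)" if "h \<in> ball 0 r" for h
    by (rule continuous_on_Times_slice[OF cont that])
  have ball: "\<forall>\<^sub>F h in at 0. h \<in> ball 0 r"
    using r by (intro eventually_at_in_open') auto
  have "((\<lambda>h. circle_mean (\<lambda>w. (F w h - F w 0) / h)) \<longlongrightarrow> circle_mean (\<lambda>w. deriv (F w) 0)) (at 0)"
  proof (rule circle_mean_uniform_limit)
    show "uniform_limit (sphere 0 1) (\<lambda>h w. (F w h - F w 0) / h) (\<lambda>w. deriv (F w) 0) (at 0)"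
      using r cont hol by (intro uniform_limit_difference_quotient) auto
    show "\<forall>\<^sub>F h in at 0. continuous_on (sphere 0 1) (\<lambda>w. (F w h - F w 0) / h)"
      using ball
    proof eventually_elim
      case (elim h)
      show ?case
        unfolding divide_inverse
        using conth[OF elim] conth[of 0] r by (intro continuous_intros) auto
    qed
  qed auto
  moreover have "\<forall>\<^sub>F h in at 0. circle_mean (\<lambda>w. (F w h - F w 0) / h)
      = (circle_mean (\<lambda>w. F w h) - circle_mean (\<lambda>w. F w 0)) / (h - 0)"
    using ball
  proof eventually_elim
    case (elim h)
    have "circle_mean (\<lambda>w. (F w h - F w 0) / h) = circle_mean (\<lambda>w. 1 / h * (F w h - F w 0))"
      by simp
    also have "\<dots> = 1 / h * (circle_mean (\<lambda>w. F w h) - circle_mean (\<lambda>w. F w 0))"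
      using conth[OF elim] conth[of 0] r by (subst circle_mean_cmult, subst circle_mean_diff) auto
    finally show ?case by simp
  qed
  ultimately show ?thesis
    unfolding has_field_derivative_iff by (rule Lim_transform_eventually)
qed

lemma holomorphic_on_circle_mean:
  assumes cont: "continuous_on (sphere 0 1 \<times> ball 0 r) (\<lambda>(w, h). F w h)"
    and hol: "\<And>w. norm w = 1 \<Longrightarrow> F w holomorphic_on ball 0 r"
  shows "(\<lambda>h. circle_mean (\<lambda>w. F w h)) holomorphic_on ball 0 r"
  unfolding holomorphic_on_open[OF open_ball]
proof
  fix h0 :: complex assume h0: "h0 \<in> ball 0 r"
  have sub: "h0 + h \<in> ball 0 r" if "h \<in> ball 0 (r - norm h0)" for h
    using that norm_triangle_ineq[of h0 h] by simp
  have "((\<lambda>h. circle_mean (\<lambda>w. F w (h0 + h))) has_field_derivative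
        circle_mean (\<lambda>w. deriv (\<lambda>h. F w (h0 + h)) 0)) (at 0)"
  proof (rule has_field_derivative_circle_mean[where r = "r - norm h0"])
    show "continuous_on (sphere 0 1 \<times> ball 0 (r - norm h0)) (\<lambda>(w, h). F w (h0 + h))"
    proof -
      have "continuous_on (sphere 0 1 \<times> ball 0 (r - norm h0)) (\<lambda>x. case (fst x, h0 + snd x) of (w, h) \<Rightarrow> F w h)"
      proof (rule continuous_on_compose2[OF cont])
        show "(\<lambda>x. (fst x, h0 + snd x)) ` (sphere 0 1 \<times> ball 0 (r - norm h0)) \<subseteq> sphere 0 1 \<times> ball 0 r"
          using sub by force
      qed (intro continuous_on_Pair continuous_on_fst continuous_on_add continuous_on_const continuous_on_snd continuous_on_id)
      then show ?thesis by (simp add: case_prod_unfold)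
    qed
    show "(\<lambda>h. F w (h0 + h)) holomorphic_on ball 0 (r - norm h0)" if "norm w = 1" for w
    proof (rule holomorphic_on_compose_gen[OF _ hol[OF that], of "\<lambda>h. h0 + h", unfolded o_def])
      show "(\<lambda>h. h0 + h) ` ball 0 (r - norm h0) \<subseteq> ball 0 r"
        unfolding image_subset_iff using sub by blast
    qed (intro holomorphic_intros)
  qed (use h0 in auto)
  then show "\<exists>d. ((\<lambda>h. circle_mean (\<lambda>w. F w h)) has_field_derivative d) (at h0)"
    using DERIV_shift[of "\<lambda>h. circle_mean (\<lambda>w. F w h)" _ 0 h0] by (auto simp: add.commute)
qed

lemma removable_quotient:
  assumes cont: "continuous_on (cball 0 1) f" and hol: "f holomorphic_on ball 0 1"
  defines "q \<equiv> \<lambda>w::complex. if w = 0 then deriv f 0 else (f w - f 0) / w"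
  shows "continuous_on (cball 0 1) q" "q holomorphic_on ball 0 1"
proof -
  show q: "q holomorphic_on ball 0 1"
    using pole_lemma_open[OF hol, of 0] unfolding q_def by (simp cong: if_cong)
  have 1: "ball 0 1 \<union> (cball 0 1 - {0}) = cball (0::complex) 1" by auto
  have "continuous_on (ball 0 1 \<union> (cball 0 1 - {0})) q"
  proof (rule continuous_on_Un_local_open; (unfold 1)?)
    show "openin (top_of_set (cball 0 1)) (ball (0::complex) 1)"
      by (intro open_subset ball_subset_cball open_ball)
    show "openin (top_of_set (cball 0 1)) (cball 0 1 - {0::complex})"
      by (intro openin_delete openin_subtopology_self)
    have "continuous_on (cball 0 1 - {0}) (\<lambda>w. (f w - f 0) / w)"
      by (intro continuous_intros continuous_on_subset[OF cont]) auto
    then show "continuous_on (cball 0 1 - {0}) q"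
      by (rule continuous_on_eq) (auto simp: q_def)
    show "continuous_on (ball 0 1) q"
      by (rule holomorphic_on_imp_continuous_on[OF q])
  qed
  then show "continuous_on (cball 0 1) q" by (simp only: 1)
qed

lemma eq_0_if_divisible_by_all_powers:
  assumes cont: "continuous_on (cball 0 1) f"
    and div: "\<And>m. \<exists>g. continuous_on (cball 0 1) g \<and> g holomorphic_on ball 0 1 \<and>
                (\<forall>w\<in>cball 0 1. f w = w ^ m * g w)"
    and w: "w \<in> cball 0 1"
  shows "f w = (0::complex)"
proof -
  obtain C where "\<And>w. w \<in> cball 0 1 \<Longrightarrow> norm (f w) \<le> C"
    by (rule compact_continuous_norm_bound[OF compact_cball cont]) blast
  then have C: "\<And>w. norm w \<le> 1 \<Longrightarrow> norm (f w) \<le> C"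
    by simp
  have est: "norm (f w) \<le> norm w ^ m * C" if w: "w \<in> ball 0 1" for w m
  proof -
    obtain g where g: "continuous_on (cball 0 1) g" "g holomorphic_on ball 0 1"
        "\<And>w. w \<in> cball 0 1 \<Longrightarrow> f w = w ^ m * g w"
      using div[of m] by auto
    have "norm (g w) \<le> C"
    proof (rule maximum_modulus_frontier[where S = "cball 0 1" and f = g and \<xi> = w])
      fix z :: complex assume "z \<in> frontier (cball 0 1)"
      then have "norm z = 1" by simp
      then show "norm (g z) \<le> C"
        using C[of z] g(3)[of z] by (simp add: norm_mult norm_power)
    qed (use g w in auto)
    then show ?thesis
      using g(3)[of w] w by (simp add: norm_mult norm_power mult_left_mono)
  qed
  have "f w = 0" if "w \<in> ball 0 1" for w
  proof -
    have "(\<lambda>m. norm w ^ m * C) \<longlonglongrightarrow> 0 * C"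
      using that by (intro tendsto_intros) auto
    then have "norm (f w) \<le> 0"
      using est[OF that] by (intro LIMSEQ_le_const[of "\<lambda>m. norm w ^ m * C"]) auto
    then show ?thesis by simp
  qed
  then show ?thesis
    using continuous_constant_on_closure[of "ball 0 1" f 0 w] cont w by auto
qed

lemma lowest_coefficient_eq_0:
  fixes f g :: "complex \<Rightarrow> complex" and a :: "complex \<Rightarrow> complex \<Rightarrow> complex"
  assumes g: "continuous_on (cball 0 1) g" "g holomorphic_on ball 0 1"
    and fg: "\<And>w. w \<in> cball 0 1 \<Longrightarrow> f w = w ^ m * g w"
    and r: "r > 0"
    and a: "continuous_on (cball 0 1 \<times> ball 0 r) (\<lambda>(w, h). a w h)"
      "\<And>h. h \<in> ball 0 r \<Longrightarrow> (\<lambda>w. a w h) holomorphic_on ball 0 1"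
      "\<And>h. h \<in> ball 0 r \<Longrightarrow> a 0 h = 1"
    and mean: "\<And>h. h \<in> ball 0 r \<Longrightarrow> circle_mean (\<lambda>w. f w * a w h * exp (- (h / w))) = 0"
  shows "g 0 = 0"
proof -
  have conta: "continuous_on (cball 0 1) (\<lambda>w. a w h)" if "h \<in> ball 0 r" for h
    by (rule continuous_on_Times_slice[OF a(1) that])
  have "continuous_on (cball 0 1 \<times> ball 0 r) (\<lambda>x. g (fst x) * (case x of (w, h) \<Rightarrow> a w h))"
    by (intro continuous_intros a(1) continuous_on_compose2[OF g(1)]) auto
  then have "continuous_on (cball 0 1 \<times> cball 0 (r/2)) (\<lambda>x. g (fst x) * (case x of (w, h) \<Rightarrow> a w h))"
    by (rule continuous_on_subset) (use r in auto)
  then obtain B where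
    "\<And>x. x \<in> cball 0 1 \<times> cball 0 (r/2) \<Longrightarrow> norm (g (fst x) * (case x of (w, h) \<Rightarrow> a w h)) \<le> B"
    by (rule compact_continuous_norm_bound[OF compact_Times[OF compact_cball compact_cball]]) blast
  then have B: "\<And>w h. norm w \<le> 1 \<Longrightarrow> norm h \<le> r/2 \<Longrightarrow> norm (g w * a w h) \<le> B"
    by fastforce
  have est: "norm (g 0) \<le> B * exp 1 * norm h" if h: "norm h \<le> r/2" "norm h \<le> 1" "h \<noteq> 0" for h :: complex
  proof -
    have hr: "h \<in> ball 0 r" using h r by auto
    define P where "P = (\<lambda>w. \<Sum>k\<le>m. (- (h / w)) ^ k / fact k)"
    have contf: "continuous_on (sphere 0 1) (\<lambda>w. w ^ n * (g w * a w h))" for n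
      by (intro continuous_intros continuous_on_subset[OF g(1)] continuous_on_subset[OF conta[OF hr]]) auto
    have contfa: "continuous_on (sphere 0 1) (\<lambda>w. f w * a w h)"
      using contf[of m] by (rule continuous_on_eq) (simp add: fg)
    have contP: "continuous_on (sphere 0 1) P"
      unfolding P_def by (intro continuous_intros) auto
    have contE: "continuous_on (sphere 0 1) (\<lambda>w. exp (- (h / w)))"
      by (intro continuous_intros) auto
    have mean_power: "circle_mean (\<lambda>w. w ^ n * (g w * a w h)) = 0 ^ n * (g 0 * a 0 h)" for n
      by (intro circle_mean_holomorphic continuous_on_mult continuous_on_power continuous_on_id
          holomorphic_intros g conta[OF hr] a(2)[OF hr])
    have "circle_mean (\<lambda>w. f w * a w h * P w) =
      circle_mean (\<lambda>w. \<Sum>k\<le>m. (- h) ^ k / fact k * (w ^ (m - k) * (g w * a w h)))"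
    proof (rule circle_mean_cong)
      fix w :: complex assume w: "norm w = 1"
      have "w ^ m * (- (h / w)) ^ k = (- h) ^ k * w ^ (m - k)" if "k \<le> m" for k
      proof -
        have "(- (h / w)) ^ k = (- h) ^ k / w ^ k" 
          by (metis minus_divide_left power_divide)
        moreover have "w ^ m = w ^ k * w ^ (m - k)"
          using that by (simp flip: power_add)
        ultimately show ?thesis using w by auto
      qed
      then show "f w * a w h * P w = (\<Sum>k\<le>m. (- h) ^ k / fact k * (w ^ (m - k) * (g w * a w h)))"
        using w by (auto simp: fg P_def sum_distrib_left intro!: sum.cong)
    qed
    also have "\<dots> = (\<Sum>k\<le>m. (- h) ^ k / fact k * circle_mean (\<lambda>w. w ^ (m - k) * (g w * a w h)))"
      by (subst circle_mean_sum) (simp_all only: circle_mean_cmult finite_atMost contf continuous_on_mult_left)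
    also have "\<dots> = (\<Sum>k\<le>m. (- h) ^ k / fact k * (0 ^ (m - k) * (g 0 * a 0 h)))"
      by (simp only: mean_power)
    also have "\<dots> = (\<Sum>k\<in>{m}. (- h) ^ k / fact k * (0 ^ (m - k) * (g 0 * a 0 h)))"
      by (rule sum.mono_neutral_right) (auto simp: power_0_left)
    also have "\<dots> = (- h) ^ m / fact m * g 0" using a(3)[OF hr] by simp
    finally have "(- h) ^ m / fact m * g 0 = 
        - circle_mean (\<lambda>w. f w * a w h * exp (- (h / w)) - f w * a w h * P w)"
      using circle_mean_diff[OF continuous_on_mult[OF contfa contE] continuous_on_mult[OF contfa contP]] mean[OF hr]
      by simp
    moreover have "norm (circle_mean (\<lambda>w. f w * a w h * exp (- (h / w)) - f w * a w h * P w))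
       \<le> B * (exp 1 * norm h ^ Suc m / fact m)"
    proof (rule circle_mean_norm_le)
      show "continuous_on (sphere 0 1) (\<lambda>w. f w * a w h * exp (- (h / w)) - f w * a w h * P w)"
        by (intro continuous_on_diff continuous_on_mult[OF contfa] contP contE)
      fix w :: complex assume w: "norm w = 1"
      have "norm (exp (- (h / w)) - P w) \<le> exp \<bar>Re (- (h / w))\<bar> * norm (- (h / w)) ^ Suc m / fact m"
        unfolding P_def by (rule Taylor_exp)
      also have "\<dots> \<le> exp 1 * norm h ^ Suc m / fact m"
      proof -
        have "\<bar>Re (- (h / w))\<bar> \<le> 1"
          using abs_Re_le_cmod[of "- (h / w)"] h w by (simp add: norm_divide)
        then show ?thesis
          using w by (intro divide_right_mono mult_mono) (auto simp: norm_divide)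
      qed
      finally have 1: "norm (exp (- (h / w)) - P w) \<le> exp 1 * norm h ^ Suc m / fact m" .
      have 2: "norm (f w * a w h) \<le> B"
        using B[of w h] h w by (simp add: fg norm_mult norm_power)
      have "f w * a w h * exp (- (h / w)) - f w * a w h * P w = (f w * a w h) * (exp (- (h / w)) - P w)"
        by (simp add: algebra_simps)
      also have "norm \<dots> \<le> B * (exp 1 * norm h ^ Suc m / fact m)"
        unfolding norm_mult[of "f w * a w h"] by (intro mult_mono 1 2 order_trans[OF norm_ge_zero 2] norm_ge_zero)
      finally show "norm (f w * a w h * exp (- (h / w)) - f w * a w h * P w) \<le> \<dots>" .
    qed
    ultimately have "norm ((- h) ^ m / fact m * g 0) \<le> B * (exp 1 * norm h ^ Suc m / fact m)"
      by simp
    then have "norm h ^ m / fact m * norm (g 0) \<le> norm h ^ m / fact m * (B * exp 1 * norm h)"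
      by (simp add: norm_mult norm_divide norm_power mult_ac)
    moreover have "norm h ^ m / fact m > 0" using h by simp
    ultimately show ?thesis by (simp only: mult_le_cancel_left_pos)
  qed
  have lim: "((\<lambda>h::complex. B * exp 1 * norm h) \<longlongrightarrow> B * exp 1 * norm (0::complex)) (at 0)"
    by (intro tendsto_mult tendsto_const tendsto_norm tendsto_ident_at)
  have ev: "\<forall>\<^sub>F h in at (0::complex). norm (g 0) \<le> B * exp 1 * norm h"
  proof -
    have "\<forall>\<^sub>F h in at (0::complex). h \<in> ball 0 (min 1 (r/2)) - {0}"
      using r by (intro eventually_at_in_open) auto
    then show ?thesis
      by eventually_elim (rule est, auto)
  qed
  have "norm (g 0) \<le> B * exp 1 * norm (0::complex)"
    by (rule tendsto_lowerbound[OF lim ev]) auto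
  then show ?thesis by simp
qed

lemma eq_0_if_circle_mean_exp_eq_0:
  fixes f :: "complex \<Rightarrow> complex" and a :: "complex \<Rightarrow> complex \<Rightarrow> complex"
  assumes f: "continuous_on (cball 0 1) f" "f holomorphic_on ball 0 1"
    and r: "r > 0"
    and a: "continuous_on (cball 0 1 \<times> ball 0 r) (\<lambda>(w, h). a w h)"
      "\<And>h. h \<in> ball 0 r \<Longrightarrow> (\<lambda>w. a w h) holomorphic_on ball 0 1"
      "\<And>h. h \<in> ball 0 r \<Longrightarrow> a 0 h = 1"
    and mean: "\<And>h. h \<in> ball 0 r \<Longrightarrow> circle_mean (\<lambda>w. f w * a w h * exp (- (h / w))) = 0"
    and w: "w \<in> cball 0 1"
  shows "f w = 0"
proof (rule eq_0_if_divisible_by_all_powers[OF f(1) _ w])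
  show "\<exists>g. continuous_on (cball 0 1) g \<and> g holomorphic_on ball 0 1 \<and> (\<forall>w\<in>cball 0 1. f w = w ^ m * g w)" for m
  proof (induction m)
    case 0
    show ?case using f by (intro exI[of _ f]) auto
  next
    case (Suc m)
    then obtain g where g: "continuous_on (cball 0 1) g" "g holomorphic_on ball 0 1"
        "\<And>w. w \<in> cball 0 1 \<Longrightarrow> f w = w ^ m * g w"
      by auto
    have g0: "g 0 = 0"
      by (rule lowest_coefficient_eq_0[OF g r a mean])
    define q where "q = (\<lambda>w. if w = 0 then deriv g 0 else (g w - g 0) / w)"
    have "\<forall>w\<in>cball 0 1. f w = w ^ Suc m * q w"
      using g(3) g0 by (auto simp: q_def)
    moreover have "continuous_on (cball 0 1) q" "q holomorphic_on ball 0 1"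
      using removable_quotient[OF g(1,2)] unfolding q_def by auto
    ultimately show ?case by blast
  qed
qed

section \<open>Clearing the poles inside the circle\<close>

definition zero_poly :: "complex set \<Rightarrow> complex poly" where
  "zero_poly Z = (\<Prod>a\<in>Z. [:- a, 1:])"

lemma poly_zero_poly_eq_0_iff: "finite Z \<Longrightarrow> poly (zero_poly Z) z = 0 \<longleftrightarrow> z \<in> Z"
  by (auto simp: zero_poly_def poly_prod)

lemma meromorphic_clear_pole:
  assumes "f meromorphic_on A" "a \<in> A"
  obtains m where "((\<lambda>z. (z - a) ^ m * f z) \<longlongrightarrow> 0) (at a)"
proof -
  obtain F where F: "(\<lambda>w. f (a + w)) has_laurent_expansion F"
    using assms unfolding meromorphic_on_def by blast
  define m where "m = nat (1 - fls_subdegree F)"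
  have "(\<lambda>w. f (a + w) * w powi int m) has_laurent_expansion fls_shift (- int m) F"
    by (rule has_laurent_expansion_shift[OF F])
  moreover have sub: "fls_nth (fls_shift (- int m) F) n = 0" if "n \<le> 0" for n
    using that by (auto simp: m_def intro!: fls_eq0_below_subdegree)
  then have "fls_subdegree (fls_shift (- int m) F) \<ge> 0"
    by (meson fls_subdegree_geI linorder_not_less fls_subdegree_ge0I not_le order.strict_implies_order)
  ultimately have "((\<lambda>w. f (a + w) * w powi int m) \<longlongrightarrow> fls_nth (fls_shift (- int m) F) 0) (at 0)"
    by (rule has_laurent_expansion_imp_tendsto_0)
  then have "((\<lambda>w. w ^ m * f (a + w)) \<longlongrightarrow> 0) (at 0)"
    using sub[of 0] by (simp add: mult.commute)
  then have "((\<lambda>z. (z - a) ^ m * f z) \<longlongrightarrow> 0) (at a)"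
    by (subst at_to_0) (simp add: filterlim_filtermap add.commute)
  then show ?thesis by (rule that)
qed

lemma meromorphic_clear_poles:
  assumes Z: "finite Z" "Z \<subseteq> ball 0 1"
    and mero: "f meromorphic_on ball 0 1" and cont: "continuous_on (cball 0 1 - Z) f"
  obtains m where
    "continuous_on (cball 0 1) (\<lambda>z. if z \<in> Z then 0 else poly (zero_poly Z) z ^ m * f z)"
proof -
  have "\<exists>m. ((\<lambda>z. (z - a) ^ m * f z) \<longlongrightarrow> 0) (at a)" if "a \<in> Z" for a
    using meromorphic_clear_pole[OF mero, of a] that Z by blast
  then obtain k where k: "\<And>a. a \<in> Z \<Longrightarrow> ((\<lambda>z. (z - a) ^ k a * f z) \<longlongrightarrow> 0) (at a)"
    by metis
  define m where "m = sum k Z"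
  define q where "q = (\<lambda>z. if z \<in> Z then 0 else poly (zero_poly Z) z ^ m * f z)"
  have lim: "((\<lambda>z. poly (zero_poly Z) z ^ m * f z) \<longlongrightarrow> 0) (at a)" if a: "a \<in> Z" for a
  proof -
    have km: "k a \<le> m" unfolding m_def using a Z by (intro member_le_sum) auto
    define R where "R = zero_poly (Z - {a})"
    have P: "poly (zero_poly Z) z = (z - a) * poly R z" for z
      using a Z unfolding R_def zero_poly_def by (subst prod.remove[of Z a]) (auto simp: left_diff_distrib)
    have "((\<lambda>z. (z - a) ^ (m - k a) * poly R z ^ m * ((z - a) ^ k a * f z)) \<longlongrightarrow>
       (a - a) ^ (m - k a) * poly R a ^ m * 0) (at a)"
      by (intro tendsto_mult k a tendsto_power tendsto_diff tendsto_ident_at tendsto_const tendsto_poly)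
    moreover have "(z - a) ^ (m - k a) * poly R z ^ m * ((z - a) ^ k a * f z) = poly (zero_poly Z) z ^ m * f z" for z
    proof -
      have "(z - a) ^ m = (z - a) ^ (m - k a) * (z - a) ^ k a"
        using km by (simp flip: power_add)
      then show ?thesis by (simp add: P power_mult_distrib)
    qed
    ultimately show ?thesis by simp
  qed
  have "continuous (at z within cball 0 1) q" if z: "z \<in> cball 0 1" for z
  proof (cases "z \<in> Z")
    case True
    have "\<forall>\<^sub>F x in at z. x \<in> - (Z - {z}) - {z}"
      using Z by (intro eventually_at_in_open open_Compl finite_imp_closed) auto
    then have "\<forall>\<^sub>F x in at z. poly (zero_poly Z) x ^ m * f x = q x"
      by eventually_elim (auto simp: q_def)
    then have q: "(q \<longlongrightarrow> 0) (at z)"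
      by (rule Lim_transform_eventually[OF lim[OF True]])
    then show ?thesis
      using True tendsto_within_subset[OF q subset_UNIV[of "cball 0 1"]] by (simp add: continuous_within q_def)
  next
    case False
    have "continuous_on (cball 0 1 - Z) (\<lambda>z. poly (zero_poly Z) z ^ m * f z)"
      by (intro continuous_intros cont)
    then have "continuous_on (cball 0 1 - Z) q"
      by (rule continuous_on_eq) (auto simp: q_def)
    then have "continuous (at z within (cball 0 1 \<inter> - Z)) q"
      using False z by (simp add: continuous_on_eq_continuous_within Diff_eq)
    moreover have "at z within (cball 0 1 \<inter> - Z) = at z within cball 0 1"
      using False Z by (intro at_within_nhd[of _ "- Z"] open_Compl finite_imp_closed) auto
    ultimately show ?thesis by simp
  qed
  then show ?thesis
    by (intro that[of m]) (auto simp: q_def continuous_on_eq_continuous_within)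
qed

lemma circle_mean_poly_moment:
  assumes cont: "continuous_on (sphere 0 1) f" and mom: "\<And>n. circle_mean (\<lambda>w. f w * w ^ Suc n) = 0"
  shows "circle_mean (\<lambda>w. f w * (w * poly q w)) = 0"
proof -
  have "circle_mean (\<lambda>w. f w * (w * poly q w)) = circle_mean (\<lambda>w. \<Sum>i\<le>degree q. coeff q i * (f w * w ^ Suc i))"
    by (intro circle_mean_cong) (simp add: poly_altdef sum_distrib_left mult_ac)
  also have "\<dots> = (\<Sum>i\<le>degree q. circle_mean (\<lambda>w. coeff q i * (f w * w ^ Suc i)))"
    by (intro circle_mean_sum) (auto intro!: continuous_intros cont)
  also have "\<dots> = 0"
    by (simp only: circle_mean_cmult mom) simp
  finally show ?thesis .
qed

lemma circle_mean_poly_kernel: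
  assumes cont: "continuous_on (sphere 0 1) f" and mom: "\<And>n. circle_mean (\<lambda>w. f w * w ^ Suc n) = 0"
    and z: "norm z < 1"
  shows "circle_mean (\<lambda>w. poly p w * f w * (w / (w - z))) = poly p z * circle_mean (\<lambda>w. f w * (w / (w - z)))"
proof -
  have "poly (p - [:poly p z:]) z = 0" by simp
  then obtain q where q: "p - [:poly p z:] = [:- z, 1:] * q"
    unfolding poly_eq_0_iff_dvd by (auto simp: dvd_def)
  have eq: "poly p w - poly p z = (w - z) * poly q w" for w
    using arg_cong[OF q, of "\<lambda>r. poly r w"] by (simp add: left_diff_distrib)
  have ne: "w \<noteq> z" if "norm w = 1" for w using that z by auto
  have "circle_mean (\<lambda>w. poly p w * f w * (w / (w - z)) - poly p z * (f w * (w / (w - z)))) =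
    circle_mean (\<lambda>w. f w * (w * poly q w))"
  proof (rule circle_mean_cong)
    fix w :: complex assume w: "norm w = 1"
    have "poly p w * f w * (w / (w - z)) - poly p z * (f w * (w / (w - z))) =
      (poly p w - poly p z) * (f w * w) / (w - z)"
      by (simp add: algebra_simps diff_divide_distrib)
    then show "poly p w * f w * (w / (w - z)) - poly p z * (f w * (w / (w - z))) = f w * (w * poly q w)"
      using ne[OF w] by (simp add: eq)
  qed
  also have "\<dots> = 0" by (rule circle_mean_poly_moment[OF cont mom])
  finally have "circle_mean (\<lambda>w. poly p w * f w * (w / (w - z))) - circle_mean (\<lambda>w. poly p z * (f w * (w / (w - z)))) = 0"
    by (subst (asm) circle_mean_diff) (auto intro!: continuous_intros cont simp: ne)
  then show ?thesis by (simp only: circle_mean_cmult right_minus_eq)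
qed

context
  fixes Z :: "complex set" and f :: "complex \<Rightarrow> complex"
  assumes Z: "finite Z" "Z \<subseteq> ball 0 1 - {0}"
    and mero: "f meromorphic_on ball 0 1" and hol: "f holomorphic_on ball 0 1 - Z"
    and cont: "continuous_on (cball 0 1 - Z) f"
begin

lemma circle_mean_cleared:
  obtains m where "\<And>n. circle_mean (\<lambda>w. poly (zero_poly Z) w ^ m * f w * w ^ Suc n) = 0"
    and "\<And>z. z \<in> ball 0 1 - Z \<Longrightarrow>
      circle_mean (\<lambda>w. poly (zero_poly Z) w ^ m * f w * (w / (w - z))) = poly (zero_poly Z) z ^ m * f z"
proof -
  obtain m where m: "continuous_on (cball 0 1) (\<lambda>z. if z \<in> Z then 0 else poly (zero_poly Z) z ^ m * f z)"
    (is "continuous_on _ ?q")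
    using meromorphic_clear_poles[OF Z(1) _ mero cont] Z(2) by blast
  have opn: "open (ball 0 1 - Z)" using Z by (intro open_Diff finite_imp_closed) auto
  have "(\<lambda>z. poly (zero_poly Z) z ^ m * f z) holomorphic_on ball 0 1 - Z"
    by (intro holomorphic_intros hol)
  then have "?q holomorphic_on ball 0 1 - Z"
    by (rule holomorphic_transform) auto
  then have diff: "?q field_differentiable at x" if "x \<in> ball 0 1 - Z" for x
    using opn that holomorphic_on_imp_differentiable_at by blast
  have circ: "z \<notin> Z" if "norm z = 1" for z using that Z by auto
  show ?thesis
  proof
    fix n
    have "circle_mean (\<lambda>w. poly (zero_poly Z) w ^ m * f w * w ^ Suc n) = circle_mean (\<lambda>w. ?q w * w ^ Suc n)"
      by (rule circle_mean_cong) (simp add: circ)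
    also have "\<dots> = ?q 0 * 0 ^ Suc n"
      using Z diff by (intro circle_mean_at_zero[of Z])
        (auto intro!: continuous_on_mult m continuous_on_power continuous_on_id field_differentiable_mult field_differentiable_power field_differentiable_ident)
    finally show "circle_mean (\<lambda>w. poly (zero_poly Z) w ^ m * f w * w ^ Suc n) = 0" by simp
  next
    fix z assume z: "z \<in> ball 0 1 - Z"
    have "circle_mean (\<lambda>w. poly (zero_poly Z) w ^ m * f w * (w / (w - z))) = circle_mean (\<lambda>w. ?q w * (w / (w - z)))"
      by (rule circle_mean_cong) (simp add: circ)
    also have "\<dots> = ?q z"
      using Z(1) m diff z by (rule circle_mean_Cauchy)
    finally show "circle_mean (\<lambda>w. poly (zero_poly Z) w ^ m * f w * (w / (w - z))) = poly (zero_poly Z) z ^ m * f z"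
      using z by simp
  qed
qed

lemma circle_mean_cleared_if_moments_eq_0:
  assumes mom: "\<And>n. circle_mean (\<lambda>w. poly (zero_poly Z) w ^ m * f w * w ^ Suc n) = 0"
    and z: "z \<in> ball 0 1 - Z"
  shows "circle_mean (\<lambda>w. poly (zero_poly Z) w ^ m * f w * (w / (w - z))) = poly (zero_poly Z) z ^ m * f z"
proof -
  let ?P = "zero_poly Z"
  obtain k where k: "\<And>n. circle_mean (\<lambda>w. poly ?P w ^ k * f w * w ^ Suc n) = 0"
    "\<And>z. z \<in> ball 0 1 - Z \<Longrightarrow> circle_mean (\<lambda>w. poly ?P w ^ k * f w * (w / (w - z))) = poly ?P z ^ k * f z"
    using circle_mean_cleared by blast
  have contf: "continuous_on (sphere 0 1) f"
    by (rule continuous_on_subset[OF cont]) (use Z in auto)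
  have cont: "continuous_on (sphere 0 1) (\<lambda>w. poly ?P w ^ j * f w)" for j
    by (intro continuous_intros contf)
  have Pz: "poly ?P z \<noteq> 0" using z Z by (simp add: poly_zero_poly_eq_0_iff)
  have zn: "norm z < 1" using z by simp
  have "poly ?P z ^ k * circle_mean (\<lambda>w. poly ?P w ^ m * f w * (w / (w - z)))
      = circle_mean (\<lambda>w. poly (?P ^ k) w * (poly ?P w ^ m * f w) * (w / (w - z)))"
    using circle_mean_poly_kernel[OF cont mom zn, of "?P ^ k"] by (simp add: poly_power)
  also have "\<dots> = circle_mean (\<lambda>w. poly (?P ^ m) w * (poly ?P w ^ k * f w) * (w / (w - z)))"
    by (simp add: poly_power mult_ac)
  also have "\<dots> = poly ?P z ^ m * (poly ?P z ^ k * f z)"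
    using circle_mean_poly_kernel[OF cont k(1) zn, of "?P ^ m"] k(2)[OF z] by (simp add: poly_power)
  finally show ?thesis using Pz by (simp add: mult_ac)
qed

lemma moments_eq_0_add:
  assumes mom: "\<And>n. circle_mean (\<lambda>w. poly (zero_poly Z) w ^ m * f w * w ^ Suc n) = 0"
  shows "circle_mean (\<lambda>w. poly (zero_poly Z) w ^ (m + d) * f w * w ^ Suc n) = 0"
proof -
  have "continuous_on (sphere 0 1) (\<lambda>w. poly (zero_poly Z) w ^ m * f w)"
    by (intro continuous_intros continuous_on_subset[OF cont]) (use Z in auto)
  from circle_mean_poly_moment[OF this mom, of "zero_poly Z ^ d * monom 1 n"]
  show ?thesis by (simp add: poly_power poly_monom power_add mult_ac)
qed

end

lemma countable_zeros_ball:
  assumes "f holomorphic_on ball 0 r" "h \<in> ball 0 r" "f h \<noteq> 0"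
  shows "countable {z \<in> ball 0 r. f z = 0}"
proof (cases "f constant_on ball 0 r")
  case True
  then have "{z \<in> ball 0 r. f z = 0} = {}" using assms unfolding constant_on_def by force
  then show ?thesis by (simp only: countable_empty)
next
  case False
  obtain C :: "nat \<Rightarrow> complex set" where C: "\<And>n. compact (C n)" "\<Union>(range C) = ball 0 r"
    by (rule open_Union_compact_subsets[of "ball 0 r :: complex set"]) auto
  have "fsigma (ball 0 r :: complex set)"
    using fsigma.intros[of C] C compact_imp_closed by metis
  then show ?thesis using assms False by (intro holomorphic_countable_zeros) auto
qed


text \<open>
  The pole orders at \<open>Z\<close> may depend on \<open>h\<close>, but they are bounded: the \<open>h\<close> for which \<open>P^m\<close> clears
  all poles form the common zero set of the moments, which are holomorphic in \<open>h\<close>, and an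
  uncountable disc is not a countable union of discrete sets.
\<close>

lemma uniform_pole_bound:
  fixes f :: "complex \<Rightarrow> complex \<Rightarrow> complex"
  assumes Z: "finite Z" "Z \<subseteq> ball 0 1 - {0}" and r: "r > 0"
    and f: "\<And>h. h \<in> ball 0 r \<Longrightarrow> (\<lambda>z. f z h) meromorphic_on ball 0 1"
      "\<And>h. h \<in> ball 0 r \<Longrightarrow> (\<lambda>z. f z h) holomorphic_on ball 0 1 - Z"
      "\<And>h. h \<in> ball 0 r \<Longrightarrow> continuous_on (cball 0 1 - Z) (\<lambda>z. f z h)"
    and cont: "continuous_on (sphere 0 1 \<times> ball 0 r) (\<lambda>(z, h). f z h)"
    and holh: "\<And>z. norm z = 1 \<Longrightarrow> f z holomorphic_on ball 0 r"
  obtains m where "\<And>h n. h \<in> ball 0 r \<Longrightarrow> circle_mean (\<lambda>w. poly (zero_poly Z) w ^ m * f w h * w ^ Suc n) = 0"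
proof -
  define M where "M = (\<lambda>m n h. circle_mean (\<lambda>w. poly (zero_poly Z) w ^ m * f w h * w ^ Suc n))"
  have holM: "M m n holomorphic_on ball 0 r" for m n
    unfolding M_def
  proof (rule holomorphic_on_circle_mean)
    have "continuous_on (sphere 0 1 \<times> ball 0 r)
        (\<lambda>x. poly (zero_poly Z) (fst x) ^ m * (case x of (w, h) \<Rightarrow> f w h) * fst x ^ Suc n)"
      by (intro continuous_intros cont)
    then show "continuous_on (sphere 0 1 \<times> ball 0 r)
        (\<lambda>(w, h). poly (zero_poly Z) w ^ m * f w h * w ^ Suc n)"
      by (simp only: case_prod_unfold)
  qed (intro holomorphic_intros holh)
  have "\<exists>m. \<forall>h\<in>ball 0 r. \<forall>n. M m n h = 0"
  proof (rule ccontr)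
    assume "\<not> ?thesis"
    then obtain n h where nh: "\<And>m. h m \<in> ball 0 r" "\<And>m. M m (n m) (h m) \<noteq> 0"
      by metis
    have "countable (\<Union>m. {z \<in> ball 0 r. M m (n m) z = 0})"
      using nh holM by (intro countable_UN countable_zeros_ball) auto
    moreover have "ball 0 r \<subseteq> (\<Union>m. {z \<in> ball 0 r. M m (n m) z = 0})"
    proof
      fix z :: complex assume z: "z \<in> ball 0 r"
      obtain m where "\<And>n. M m n z = 0"
        unfolding M_def by (rule circle_mean_cleared[OF Z f[OF z]]) blast
      then show "z \<in> (\<Union>m. {z \<in> ball 0 r. M m (n m) z = 0})" using z by blast
    qed
    ultimately show False
      using countable_subset uncountable_ball[OF r] by blast
  qed
  then show ?thesis using that unfolding M_def by blast
qed

lemma has_field_derivative_continuation: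
  fixes f :: "complex \<Rightarrow> complex \<Rightarrow> complex"
  assumes Z: "finite Z" "Z \<subseteq> ball 0 1 - {0}" and r: "r > 0"
    and f: "\<And>h. h \<in> ball 0 r \<Longrightarrow> (\<lambda>z. f z h) meromorphic_on ball 0 1"
      "\<And>h. h \<in> ball 0 r \<Longrightarrow> (\<lambda>z. f z h) holomorphic_on ball 0 1 - Z"
      "\<And>h. h \<in> ball 0 r \<Longrightarrow> continuous_on (cball 0 1 - Z) (\<lambda>z. f z h)"
    and e: "e meromorphic_on ball 0 1" "e holomorphic_on ball 0 1 - Z" "continuous_on (cball 0 1 - Z) e"
    and cont: "continuous_on (sphere 0 1 \<times> ball 0 r) (\<lambda>(z, h). f z h)"
    and holh: "\<And>z. norm z = 1 \<Longrightarrow> f z holomorphic_on ball 0 r"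
    and deriv: "\<And>z. norm z = 1 \<Longrightarrow> deriv (f z) 0 = c * e z"
    and z: "z \<in> ball 0 1 - Z"
  shows "(f z has_field_derivative c * e z) (at 0)"
proof -
  let ?P = "poly (zero_poly Z)"
  obtain m1 where m1: "\<And>h n. h \<in> ball 0 r \<Longrightarrow> circle_mean (\<lambda>w. ?P w ^ m1 * f w h * w ^ Suc n) = 0"
    using uniform_pole_bound[OF Z r f cont holh] by blast
  obtain m2 where m2: "\<And>n. circle_mean (\<lambda>w. ?P w ^ m2 * e w * w ^ Suc n) = 0"
    by (rule circle_mean_cleared[OF Z e]) blast
  define m where "m = m1 + m2"
  have Pz: "?P z \<noteq> 0" using z Z by (simp add: poly_zero_poly_eq_0_iff)
  have ne: "w \<noteq> z" if "norm w = 1" for w using z that by auto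
  have F: "circle_mean (\<lambda>w. ?P w ^ m * f w h * (w / (w - z))) = ?P z ^ m * f z h" if "h \<in> ball 0 r" for h
    unfolding m_def
    by (intro circle_mean_cleared_if_moments_eq_0[OF Z f[OF that] _ z] moments_eq_0_add[OF Z f[OF that]] m1 that)
  have E: "circle_mean (\<lambda>w. ?P w ^ m * e w * (w / (w - z))) = ?P z ^ m * e z"
    unfolding m_def add.commute[of m1]
    by (intro circle_mean_cleared_if_moments_eq_0[OF Z e _ z] moments_eq_0_add[OF Z e] m2)
  have "((\<lambda>h. circle_mean (\<lambda>w. ?P w ^ m * f w h * (w / (w - z)))) has_field_derivative
      circle_mean (\<lambda>w. deriv (\<lambda>h. ?P w ^ m * f w h * (w / (w - z))) 0)) (at 0)"
  proof (rule has_field_derivative_circle_mean[OF r])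
    have "continuous_on (sphere 0 1 \<times> ball 0 r)
        (\<lambda>x. ?P (fst x) ^ m * (case x of (w, h) \<Rightarrow> f w h) * (fst x / (fst x - z)))"
      using ne by (intro continuous_intros cont) auto
    then show "continuous_on (sphere 0 1 \<times> ball 0 r) (\<lambda>(w, h). ?P w ^ m * f w h * (w / (w - z)))"
      by (simp only: case_prod_unfold)
  qed (intro holomorphic_intros holh)
  also have "circle_mean (\<lambda>w. deriv (\<lambda>h. ?P w ^ m * f w h * (w / (w - z))) 0)
      = circle_mean (\<lambda>w. c * (?P w ^ m * e w * (w / (w - z))))"
  proof (rule circle_mean_cong)
    fix w :: complex assume w: "norm w = 1"
    have "f w field_differentiable at 0"
      using holh[OF w] r by (intro holomorphic_on_imp_differentiable_at[of _ "ball 0 r"]) auto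
    then have "(f w has_field_derivative c * e w) (at 0)"
      using deriv[OF w] by (metis DERIV_deriv_iff_field_differentiable)
    then have "((\<lambda>h. ?P w ^ m * f w h * (w / (w - z))) has_field_derivative
        ?P w ^ m * (c * e w) * (w / (w - z))) (at 0)"
      by (intro DERIV_cmult DERIV_cmult_right)
    then show "deriv (\<lambda>h. ?P w ^ m * f w h * (w / (w - z))) 0 = c * (?P w ^ m * e w * (w / (w - z)))"
      by (simp add: DERIV_imp_deriv mult_ac)
  qed
  finally have "((\<lambda>h. circle_mean (\<lambda>w. ?P w ^ m * f w h * (w / (w - z)))) has_field_derivative
      c * (?P z ^ m * e z)) (at 0)"
    by (simp only: circle_mean_cmult E)
  then have "((\<lambda>h. ?P z ^ m * f z h) has_field_derivative c * (?P z ^ m * e z)) (at 0)"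
    by (rule has_field_derivative_transform_within_open[of _ _ _ "ball 0 r"]) (use F r in auto)
  from DERIV_cmult[OF this, of "1 / ?P z ^ m"] show ?thesis
    using Pz by simp
qed

section \<open>The normalised Baker matrix\<close>

lemma deriv_holomorphic_family:
  fixes F :: "complex \<Rightarrow> complex \<Rightarrow> complex"
  assumes r: "r > 0" and cont: "continuous_on (cball 0 1 \<times> ball 0 r) (\<lambda>(w, h). F w h)"
    and holw: "\<And>h. h \<in> ball 0 r \<Longrightarrow> (\<lambda>w. F w h) holomorphic_on ball 0 1"
    and holh: "\<And>w. w \<in> cball 0 1 \<Longrightarrow> F w holomorphic_on ball 0 r"
  defines "D \<equiv> \<lambda>w. deriv (F w) 0"
  shows "continuous_on (cball 0 1) D" "D holomorphic_on ball 0 1"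
    "((\<lambda>h. deriv (\<lambda>w. F w h) 0) has_field_derivative deriv D 0) (at 0)"
proof -
  define Q where "Q = (\<lambda>h w. (F w h - F w 0) / h)"
  define Q' where "Q' = (\<lambda>h w. (deriv (\<lambda>w. F w h) w - deriv (\<lambda>w. F w 0) w) / h)"
  have lim: "uniform_limit (cball 0 1) Q D (at 0)"
    unfolding Q_def D_def by (rule uniform_limit_difference_quotient[OF compact_cball r cont holh])
  have ball: "\<forall>\<^sub>F h in at 0. h \<in> ball 0 r - {0}"
    using r by (intro eventually_at_in_open) auto
  have der: "((\<lambda>w. F w h) has_field_derivative deriv (\<lambda>w. F w h) w) (at w)"
    if "h \<in> ball 0 r" "w \<in> ball 0 1" for h w
    using holomorphic_derivI[OF holw[OF that(1)] open_ball that(2)] .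
  have ev: "\<forall>\<^sub>F h in at 0. continuous_on (cball 0 1) (Q h) \<and>
      (\<forall>w\<in>ball 0 1. (Q h has_field_derivative Q' h w) (at w))"
    using ball
  proof eventually_elim
    case (elim h)
    have h: "h \<in> ball 0 r" "0 \<in> ball (0::complex) r" using elim r by auto
    have "continuous_on (cball 0 1) (Q h)"
      unfolding Q_def using elim
      by (intro continuous_on_divide continuous_on_diff continuous_on_const
          continuous_on_Times_slice[OF cont h(1)] continuous_on_Times_slice[OF cont h(2)]) auto
    moreover have "(Q h has_field_derivative Q' h w) (at w)" if "w \<in> ball 0 1" for w
      unfolding Q_def Q'_def using der that h by (intro DERIV_cdivide DERIV_diff) auto
    ultimately show ?case by blast
  qed
  obtain g' where g': "continuous_on (cball 0 1) D"
    "\<And>w. w \<in> ball 0 1 \<Longrightarrow> (D has_field_derivative (g' w)) (at w) \<and> ((\<lambda>h. Q' h w) \<longlongrightarrow> g' w) (at 0)"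
    using has_complex_derivative_uniform_limit[OF ev lim] by auto
  show "continuous_on (cball 0 1) D" by fact
  show "D holomorphic_on ball 0 1"
    using g'(2) holomorphic_on_open[OF open_ball] by blast
  have "deriv D 0 = g' 0"
    using g'(2)[of 0] by (auto intro: DERIV_imp_deriv)
  then show "((\<lambda>h. deriv (\<lambda>w. F w h) 0) has_field_derivative deriv D 0) (at 0)"
    using g'(2)[of 0] by (simp add: has_field_derivative_iff Q'_def)
qed

lemma matrix_inv_mult:
  fixes A :: "'a::field ^ 'n ^ 'n"
  assumes "invertible A"
  shows "matrix_inv A ** A = mat 1" "A ** matrix_inv A = mat 1"
  using someI_ex[OF assms[unfolded invertible_def]] unfolding matrix_inv_def by auto

lemma matrix_inv_entry:
  fixes A :: "'a::field ^ 'n ^ 'n"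
  assumes "invertible A"
  shows "matrix_inv A $ k $ l = det (\<chi> i j. if j = k then axis l 1 $ i else A $ i $ j) / det A"
proof -
  have "A *v column l (matrix_inv A) = axis l 1"
    using matrix_inv_mult(2)[OF assms]
    by (simp add: vec_eq_iff matrix_vector_mult_def matrix_matrix_mult_def column_def mat_def axis_def)
  moreover have "det A \<noteq> 0" using assms by (simp add: invertible_det_nz)
  ultimately have "column l (matrix_inv A) = (\<chi> k. det (\<chi> i j. if j = k then axis l 1 $ i else A $ i $ j) / det A)"
    by (simp add: cramer)
  then show ?thesis by (simp add: vec_eq_iff column_def)
qed

lemma holomorphic_on_det:
  fixes A :: "complex \<Rightarrow> complex ^ 'n ^ 'n"
  assumes "\<And>i j. (\<lambda>x. A x $ i $ j) holomorphic_on U"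
  shows "(\<lambda>x. det (A x)) holomorphic_on U"
  unfolding det_def by (intro holomorphic_intros assms)

lemma holomorphic_on_matrix_inv_entry:
  fixes A :: "complex \<Rightarrow> complex ^ 'n ^ 'n"
  assumes "\<And>i j. (\<lambda>x. A x $ i $ j) holomorphic_on U" "\<And>x. x \<in> U \<Longrightarrow> invertible (A x)"
  shows "(\<lambda>x. matrix_inv (A x) $ k $ l) holomorphic_on U"
proof -
  have "(\<lambda>x. if j = k then axis l 1 $ i else A x $ i $ j) holomorphic_on U" for i j
    using assms(1) by (cases "j = k") auto
  then have "(\<lambda>x. det (\<chi> i j. if j = k then axis l 1 $ i else A x $ i $ j) / det (A x)) holomorphic_on U"
    using assms by (intro holomorphic_on_divide holomorphic_on_det) (auto simp: invertible_det_nz)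
  then show ?thesis
    by (rule holomorphic_transform) (simp add: matrix_inv_entry assms)
qed

lemma sum_swap3: "(\<Sum>k\<in>K. \<Sum>a\<in>A. \<Sum>b\<in>B. f k a b) = (\<Sum>a\<in>A. \<Sum>b\<in>B. \<Sum>k\<in>K. f k a b)"
proof -
  have "(\<Sum>k\<in>K. \<Sum>a\<in>A. \<Sum>b\<in>B. f k a b) = (\<Sum>a\<in>A. \<Sum>k\<in>K. \<Sum>b\<in>B. f k a b)"
    by (rule sum.swap)
  also have "\<dots> = (\<Sum>a\<in>A. \<Sum>b\<in>B. \<Sum>k\<in>K. f k a b)"
    by (intro sum.cong refl sum.swap)
  finally show ?thesis .
qed

lemma xi_u_shift:
  assumes "summable (\<lambda>n. z ^ (2 * n + 1) * t i n)"
  shows "xi z (u_shift s t i) = xi z (t i) + z * s $ i"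
proof -
  have "(\<lambda>n. z ^ (2 * n + 1) * t i n + (if n = 0 then z * s $ i else 0)) sums (xi z (t i) + z * s $ i)"
    unfolding xi_def by (intro sums_add summable_sums assms sums_single)
  also have "(\<lambda>n. z ^ (2 * n + 1) * t i n + (if n = 0 then z * s $ i else 0)) = (\<lambda>n. z ^ (2 * n + 1) * u_shift s t i n)"
    by (auto simp: u_shift_def algebra_simps)
  finally show ?thesis unfolding xi_def by (rule sums_unique[symmetric])
qed

lemma continuous_on_xi:
  assumes "\<And>z. summable (\<lambda>n. z ^ (2 * n + 1) * a n)"
  shows "continuous_on U (\<lambda>z. xi z a)"
proof -
  have sm: "summable (\<lambda>n. a n * x ^ n)" for x :: complex
  proof (cases "x = 0")
    case True
    then show ?thesis by (simp add: summable_0_powser)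
  next
    case False
    have eq: "csqrt x ^ (2 * n + 1) * a n = csqrt x * (a n * x ^ n)" for n
      by (simp add: power_mult)
    have "summable (\<lambda>n. csqrt x * (a n * x ^ n))"
      using assms[of "csqrt x"] unfolding eq .
    then show ?thesis using False by (simp add: summable_cmult_iff)
  qed
  have "continuous_on UNIV (\<lambda>x. \<Sum>n. a n * x ^ n)"
    by (intro continuous_at_imp_continuous_on ballI isCont_powser_converges_everywhere sm)
  then have "continuous_on U (\<lambda>z. \<Sum>n. a n * (z^2) ^ n)"
    by (rule continuous_on_compose2) (intro continuous_on_power continuous_on_id, rule subset_UNIV)
  then have "continuous_on U (\<lambda>z. z * (\<Sum>n. a n * (z^2) ^ n))"
    by (intro continuous_on_mult continuous_on_id)
  moreover have "z * (\<Sum>n. a n * (z^2) ^ n) = xi z a" for z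
  proof -
    have "z ^ (2 * n + 1) * a n = z * (a n * (z^2) ^ n)" for n
      by (simp add: power_mult)
    then show ?thesis
      unfolding xi_def by (simp only: suminf_mult[OF sm[of "z^2"], of z])
  qed
  ultimately show ?thesis by simp
qed

lemma bracket_uminus: "bracket (- w) n = - bracket w n"
  by (simp add: bracket_def)

lemma time_plus_bracket: "time_plus t (bracket w) j = time_minus t (bracket (- w)) j"
  by (simp add: time_plus_def time_minus_def bracket_uminus)

lemma time_minus_bracket_0: "time_minus t (bracket 0) j = t"
  by (simp add: time_minus_def bracket_def)

lemma u_shift_0: "u_shift 0 t = t"
  by (intro ext) (simp add: u_shift_def)

definition normalized_baker ::
  "('n::finite \<Rightarrow> 'n \<Rightarrow> 'n bkp_times \<Rightarrow> complex) \<Rightarrow> complex \<Rightarrow> 'n bkp_times \<Rightarrow> complex ^ 'n ^ 'n" where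
  "normalized_baker \<tau> w t = matrix_inv (tau_matrix \<tau> t) ** (\<chi> i j. \<tau> i j (time_minus t (bracket w) j))"

lemma normalized_baker_entry:
  "normalized_baker \<tau> w t $ i $ k = (\<Sum>a\<in>UNIV. matrix_inv (tau_matrix \<tau> t) $ i $ a * \<tau> a k (time_minus t (bracket w) k))"
  by (simp add: normalized_baker_def matrix_matrix_mult_def)

lemma chi_matrix_eq: "chi_matrix \<tau> z t = normalized_baker \<tau> (1 / z) t"
  by (simp add: chi_matrix_def normalized_baker_def)

lemma baker_matrix_entry:
  "baker_matrix \<tau> z t $ i $ k = normalized_baker \<tau> (1 / z) t $ i $ k * exp (xi z (t k))"
  by (simp add: baker_matrix_def phi_matrix_def normalized_baker_entry matrix_matrix_mult_def
      sum_distrib_right mult.assoc)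

lemma G_matrix_entry:
  "G_matrix \<tau> t $ i $ c = (\<Sum>a\<in>UNIV. matrix_inv (tau_matrix \<tau> t) $ i $ a * \<tau> c a t)"
  by (simp add: G_matrix_def matrix_matrix_mult_def transpose_def tau_matrix_def)

lemma mult_transpose_entry:
  "(A ** transpose B) $ i $ l = (\<Sum>c\<in>UNIV. A $ i $ c * B $ l $ c)"
  by (simp add: matrix_matrix_mult_def transpose_def)

locale bkp =
  fixes S :: "('n::finite bkp_times) set"
    and \<tau>0 :: "'n bkp_times \<Rightarrow> complex"
    and \<tau> :: "'n \<Rightarrow> 'n \<Rightarrow> 'n bkp_times \<Rightarrow> complex"
  assumes suitable: "suitable_times S \<tau>"
    and tau: "bkp_tau_functions S \<tau>0 \<tau>"
    and inv: "\<forall>t\<in>S. invertible (tau_matrix \<tau> t)"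
begin

abbreviation X :: "complex \<Rightarrow> 'n bkp_times \<Rightarrow> complex ^ 'n ^ 'n" where
  "X \<equiv> normalized_baker \<tau>"

abbreviation g :: "'n bkp_times \<Rightarrow> complex ^ 'n ^ 'n" where
  "g \<equiv> G_matrix \<tau>"

lemma summable_xi: "t \<in> S \<Longrightarrow> summable (\<lambda>n. z ^ (2 * n + 1) * t i n)"
  using suitable unfolding suitable_times_def by blast

lemma X_0: "t \<in> S \<Longrightarrow> X 0 t = mat 1"
  using matrix_inv_mult(1)[of "tau_matrix \<tau> t"] inv
  by (simp add: normalized_baker_def time_minus_bracket_0 tau_matrix_def)

lemma suitable_radius:
  assumes t: "t \<in> S"
  obtains r where "r > 0" "\<And>s. s \<in> ball 0 r \<Longrightarrow> u_shift s t \<in> S"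
    "\<And>i j. continuous_on (cball 0 1 \<times> ball 0 r) (\<lambda>(w, s). \<tau> i j (time_minus (u_shift s t) (bracket w) j))"
    "\<And>i j s. s \<in> ball 0 r \<Longrightarrow> (\<lambda>w. \<tau> i j (time_minus (u_shift s t) (bracket w) j)) holomorphic_on ball 0 1"
    "\<And>i j k w s. w \<in> cball 0 1 \<Longrightarrow> s \<in> ball 0 r \<Longrightarrow>
      (\<lambda>x. \<tau> i j (time_minus (u_shift (s + axis k x) t) (bracket w) j)) field_differentiable at 0"
proof -
  have "\<exists>r>0. (\<forall>s \<in> ball 0 r. u_shift s t \<in> S) \<and>
         (\<forall>i j.
            continuous_on (cball 0 1 \<times> ball 0 r) (\<lambda>(w, s). \<tau> i j (time_minus (u_shift s t) (bracket w) j)) \<and>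
            (\<forall>s \<in> ball 0 r. (\<lambda>w. \<tau> i j (time_minus (u_shift s t) (bracket w) j)) holomorphic_on ball 0 1) \<and>
            (\<forall>w \<in> cball 0 1. \<forall>s \<in> ball 0 r. \<forall>k.
               (\<lambda>x. \<tau> i j (time_minus (u_shift (s + axis k x) t) (bracket w) j)) field_differentiable (at 0)))"
    using bspec[OF suitable[unfolded suitable_times_def Let_def] t] by (rule conjunct2)
  then show ?thesis
    by (elim exE conjE) (rule that, assumption, blast+)
qed

lemma continuous_tau:
  assumes t: "t \<in> S"
  shows "continuous_on (cball 0 1) (\<lambda>w. \<tau> i j (time_minus t (bracket w) j))"
proof -
  obtain r where r: "r > 0" "continuous_on (cball 0 1 \<times> ball 0 r)
      (\<lambda>(w, s). \<tau> i j (time_minus (u_shift s t) (bracket w) j))"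
    by (rule suitable_radius[OF t]) blast
  from continuous_on_Times_slice[OF r(2), of 0] show ?thesis
    using r(1) by (simp add: u_shift_0)
qed

lemma continuous_X: "t \<in> S \<Longrightarrow> continuous_on (cball 0 1) (\<lambda>w. X w t $ i $ k)"
  unfolding normalized_baker_entry by (intro continuous_intros continuous_tau)

lemma bilinear:
  assumes t: "t \<in> S" and t': "t' \<in> S"
  shows "(\<Sum>k\<in>UNIV. circle_mean (\<lambda>w. exp (xi (1 / w) (t k) - xi (1 / w) (t' k)) * (X w t $ i $ k * X (- w) t' $ l $ k)))
    = (g t ** transpose (g t')) $ i $ l"
proof -
  define E where "E = (\<lambda>k w. exp (xi (1 / w) (t k) - xi (1 / w) (t' k)))"
  define M where "M = (\<lambda>a k w. \<tau> a k (time_minus t (bracket w) k))"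
  define M' where "M' = (\<lambda>a k w. \<tau> a k (time_minus t' (bracket (- w)) k))"
  define A where "A = matrix_inv (tau_matrix \<tau> t)"
  define B where "B = matrix_inv (tau_matrix \<tau> t')"
  have contxi: "continuous_on (sphere 0 1) (\<lambda>w. xi (1 / w) (t k))" if "t \<in> S" for t k
    using summable_xi[OF that]
    by (intro continuous_on_compose2[OF continuous_on_xi[of "t k" UNIV]] continuous_intros) auto
  have contE: "continuous_on (sphere 0 1) (E k)" for k
    unfolding E_def by (intro continuous_intros contxi t t')
  have contM: "continuous_on (sphere 0 1) (M a k)" for a k
    unfolding M_def by (rule continuous_on_subset[OF continuous_tau[OF t]]) auto
  have contM': "continuous_on (sphere 0 1) (M' a k)" for a k
    unfolding M'_def
    by (rule continuous_on_compose2[OF continuous_tau[OF t']]) (auto intro!: continuous_intros)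
  have tau_eq: "(\<Sum>k\<in>UNIV. circle_mean (\<lambda>w. E k w * (M a k w * M' b k w))) = (\<Sum>c\<in>UNIV. \<tau> c a t * \<tau> c b t')" for a b
  proof -
    have "(\<Sum>c\<in>UNIV. \<tau> c a t * \<tau> c b t') = (\<Sum>k\<in>UNIV. contour_integral (circlepath 0 1)
           (\<lambda>z. 1 / (2 * of_real pi * \<i> * z) * exp (xi z (t k) - xi z (t' k)) *
                \<tau> a k (time_minus t (bracket (1 / z)) k) * \<tau> b k (time_plus t' (bracket (1 / z)) k)))"
      using tau t t' unfolding bkp_tau_functions_def by simp
    also have "\<dots> = (\<Sum>k\<in>UNIV. circle_mean (\<lambda>z. E k (1 / z) * (M a k (1 / z) * M' b k (1 / z))))"
    proof (intro sum.cong refl)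
      fix k
      have "1 / (2 * of_real pi * \<i> * z) * exp (xi z (t k) - xi z (t' k)) *
                \<tau> a k (time_minus t (bracket (1 / z)) k) * \<tau> b k (time_plus t' (bracket (1 / z)) k)
          = 1 / (2 * of_real pi * \<i> * z) * (E k (1 / z) * (M a k (1 / z) * M' b k (1 / z)))" for z
        by (simp add: E_def M_def M'_def time_plus_bracket)
      then show "contour_integral (circlepath 0 1)
           (\<lambda>z. 1 / (2 * of_real pi * \<i> * z) * exp (xi z (t k) - xi z (t' k)) *
                \<tau> a k (time_minus t (bracket (1 / z)) k) * \<tau> b k (time_plus t' (bracket (1 / z)) k))
          = circle_mean (\<lambda>z. E k (1 / z) * (M a k (1 / z) * M' b k (1 / z)))"
        by (simp only: contour_integral_eq_circle_mean)
    qed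
    also have "\<dots> = (\<Sum>k\<in>UNIV. circle_mean (\<lambda>w. E k w * (M a k w * M' b k w)))"
      by (intro sum.cong refl circle_mean_inverse)
    finally show ?thesis ..
  qed
  have XM: "X w t $ i $ k = (\<Sum>a\<in>UNIV. A $ i $ a * M a k w)" for w k
    by (simp add: normalized_baker_entry A_def M_def)
  have XM': "X (- w) t' $ l $ k = (\<Sum>a\<in>UNIV. B $ l $ a * M' a k w)" for w k
    by (simp add: normalized_baker_entry B_def M'_def)
  have expand: "circle_mean (\<lambda>w. E k w * (X w t $ i $ k * X (- w) t' $ l $ k))
     = (\<Sum>a\<in>UNIV. \<Sum>b\<in>UNIV. A $ i $ a * B $ l $ b * circle_mean (\<lambda>w. E k w * (M a k w * M' b k w)))" for k
  proof -
    have "circle_mean (\<lambda>w. E k w * (X w t $ i $ k * X (- w) t' $ l $ k))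
      = circle_mean (\<lambda>w. \<Sum>a\<in>UNIV. \<Sum>b\<in>UNIV. A $ i $ a * B $ l $ b * (E k w * (M a k w * M' b k w)))"
      unfolding XM XM' unfolding sum_product unfolding sum_distrib_left
      by (intro circle_mean_cong sum.cong refl) (simp only: mult_ac)
    also have "\<dots> = (\<Sum>a\<in>UNIV. circle_mean (\<lambda>w. \<Sum>b\<in>UNIV. A $ i $ a * B $ l $ b * (E k w * (M a k w * M' b k w))))"
      by (intro circle_mean_sum finite continuous_intros contE contM contM')
    also have "\<dots> = (\<Sum>a\<in>UNIV. \<Sum>b\<in>UNIV. circle_mean (\<lambda>w. A $ i $ a * B $ l $ b * (E k w * (M a k w * M' b k w))))"
      by (intro sum.cong refl circle_mean_sum finite continuous_intros contE contM contM')
    finally show ?thesis by (simp only: circle_mean_cmult)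
  qed
  have "(\<Sum>k\<in>UNIV. circle_mean (\<lambda>w. E k w * (X w t $ i $ k * X (- w) t' $ l $ k)))
    = (\<Sum>a\<in>UNIV. \<Sum>b\<in>UNIV. A $ i $ a * B $ l $ b * (\<Sum>k\<in>UNIV. circle_mean (\<lambda>w. E k w * (M a k w * M' b k w))))"
    unfolding expand sum_distrib_left by (rule sum_swap3)
  also have "\<dots> = (\<Sum>a\<in>UNIV. \<Sum>b\<in>UNIV. \<Sum>c\<in>UNIV. (A $ i $ a * \<tau> c a t) * (B $ l $ b * \<tau> c b t'))"
    unfolding tau_eq sum_distrib_left by (simp add: mult_ac)
  also have "\<dots> = (\<Sum>c\<in>UNIV. \<Sum>a\<in>UNIV. \<Sum>b\<in>UNIV. (A $ i $ a * \<tau> c a t) * (B $ l $ b * \<tau> c b t'))"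
    by (rule sum_swap3[symmetric])
  also have "\<dots> = (g t ** transpose (g t')) $ i $ l"
    by (simp only: mult_transpose_entry G_matrix_entry sum_product A_def B_def)
  finally show ?thesis unfolding E_def .
qed

end

lemma norm_axis: "norm (axis j h :: complex ^ 'n) = norm h"
proof -
  have "(\<Sum>i\<in>UNIV. (norm ((axis j h :: complex ^ 'n) $ i))\<^sup>2) = (\<Sum>i\<in>UNIV. if i = j then (norm h)\<^sup>2 else 0)"
    by (intro sum.cong) (auto simp: axis_def)
  then show ?thesis
    by (simp add: norm_vec_def L2_set_def)
qed

lemma u_shift_axis_0: "u_shift (axis j 0) t = t"
  by (simp add: u_shift_def axis_def fun_eq_iff)

lemma holomorphic_on_reflect:
  assumes "f holomorphic_on ball 0 r"
  shows "(\<lambda>w. f (- w)) holomorphic_on ball 0 r"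
  by (rule holomorphic_on_compose_gen[OF _ assms, of uminus, unfolded o_def]) (auto intro!: holomorphic_intros)

lemma continuous_on_reflect:
  fixes f :: "complex \<Rightarrow> complex"
  assumes "continuous_on (cball 0 r) f"
  shows "continuous_on (cball 0 r) (\<lambda>w. f (- w))"
  by (rule continuous_on_compose2[OF assms]) (auto intro!: continuous_intros)

locale bkp_slice = bkp S \<tau>0 \<tau>
  for S :: "('n::finite bkp_times) set" and \<tau>0 \<tau> +
  fixes t :: "'n bkp_times" and r :: real
  assumes t: "t \<in> S" and r: "r > 0"
    and shift_in_S: "\<And>j h. h \<in> ball 0 r \<Longrightarrow> u_shift (axis j h) t \<in> S"
    and X_cont: "\<And>i j k. continuous_on (cball 0 1 \<times> ball 0 r) (\<lambda>(w, h). X w (u_shift (axis j h) t) $ i $ k)"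
    and X_holw: "\<And>i j k h. h \<in> ball 0 r \<Longrightarrow> (\<lambda>w. X w (u_shift (axis j h) t) $ i $ k) holomorphic_on ball 0 1"
    and X_holh: "\<And>i j k w. w \<in> cball 0 1 \<Longrightarrow> (\<lambda>h. X w (u_shift (axis j h) t) $ i $ k) holomorphic_on ball 0 r"
    and g_hol: "\<And>i j k. (\<lambda>h. g (u_shift (axis j h) t) $ i $ k) holomorphic_on ball 0 r"

lemma (in bkp) slice_exists:
  assumes t: "t \<in> S"
  obtains r where "bkp_slice S \<tau>0 \<tau> t r"
proof -
  obtain r where r: "r > 0" and inS: "\<And>s. s \<in> ball 0 r \<Longrightarrow> u_shift s t \<in> S"
    and cont: "\<And>i j. continuous_on (cball 0 1 \<times> ball 0 r) (\<lambda>(w, s). \<tau> i j (time_minus (u_shift s t) (bracket w) j))"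
    and holw: "\<And>i j s. s \<in> ball 0 r \<Longrightarrow> (\<lambda>w. \<tau> i j (time_minus (u_shift s t) (bracket w) j)) holomorphic_on ball 0 1"
    and diff: "\<And>i j k w s. w \<in> cball 0 1 \<Longrightarrow> s \<in> ball 0 r \<Longrightarrow>
      (\<lambda>x. \<tau> i j (time_minus (u_shift (s + axis k x) t) (bracket w) j)) field_differentiable at 0"
    by (rule suitable_radius[OF t]) blast
  have axis: "axis j h \<in> ball (0 :: complex ^ 'n) r" if "h \<in> ball 0 r" for j h
    using that by (simp add: norm_axis)
  define M where "M = (\<lambda>j a k w h. \<tau> a k (time_minus (u_shift (axis j h) t) (bracket w) k))"
  have M_eq: "\<tau> a k (time_minus (u_shift (axis j h) t) (bracket w) k) = M j a k w h" for j a k w h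
    by (simp add: M_def)
  have M_cont: "continuous_on (cball 0 1 \<times> ball 0 r) (\<lambda>x. M j a k (fst x) (snd x))" for j a k
  proof -
    have "continuous_on (cball 0 1 \<times> ball 0 r)
        (\<lambda>x. case (fst x, axis j (snd x)) of (w, s) \<Rightarrow> \<tau> a k (time_minus (u_shift s t) (bracket w) k))"
    proof (rule continuous_on_compose2[OF cont])
      have "continuous_on (cball 0 1 \<times> ball 0 r) (\<lambda>x::complex \<times> complex. if i = j then snd x else 0)" for i
        by (cases "i = j") (auto intro!: continuous_intros)
      then show "continuous_on (cball 0 1 \<times> ball 0 r) (\<lambda>x::complex \<times> complex. (fst x, axis j (snd x) :: complex ^ 'n))"
        unfolding axis_def
        by (intro continuous_on_Pair continuous_on_fst continuous_on_id continuous_on_vec_lambda)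
      show "(\<lambda>x::complex \<times> complex. (fst x, axis j (snd x))) ` (cball 0 1 \<times> ball 0 r) \<subseteq> cball 0 1 \<times> ball 0 r"
        by (auto simp: norm_axis)
    qed
    then show ?thesis by (simp add: M_def)
  qed
  have M_holw: "M j a k w holomorphic_on ball 0 r" if w: "w \<in> cball 0 1" for j a k w
    unfolding holomorphic_on_open[OF open_ball]
  proof
    fix h :: complex assume h: "h \<in> ball 0 r"
    have "axis j (h + x) = axis j h + (axis j x :: complex ^ 'n)" for x
      by (simp add: vec_eq_iff axis_def)
    then have "(\<lambda>x. M j a k w (h + x)) field_differentiable at 0"
      unfolding M_def using diff[OF w axis[OF h]] by simp
    then obtain d where "((\<lambda>x. M j a k w (h + x)) has_field_derivative d) (at 0)"
      by (auto simp: field_differentiable_def)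
    then show "\<exists>d. (M j a k w has_field_derivative d) (at h)"
      using DERIV_shift[of "M j a k w" d 0 h] by (auto simp: add.commute)
  qed
  have T: "tau_matrix \<tau> (u_shift (axis j h) t) $ a $ k = M j a k 0 h" for j a k h
    by (simp add: M_def tau_matrix_def time_minus_bracket_0)
  have inv': "invertible (tau_matrix \<tau> (u_shift (axis j h) t))" if "h \<in> ball 0 r" for j h
    using inv inS[OF axis[OF that]] by blast
  have Tinv_hol: "(\<lambda>h. matrix_inv (tau_matrix \<tau> (u_shift (axis j h) t)) $ i $ a) holomorphic_on ball 0 r" for j i a
    by (rule holomorphic_on_matrix_inv_entry) (simp_all add: T M_holw inv')
  have Tinv_cont: "continuous_on (cball 0 1 \<times> ball 0 r)
      (\<lambda>x. matrix_inv (tau_matrix \<tau> (u_shift (axis j (snd x)) t)) $ i $ a)" for j i a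
    by (rule continuous_on_compose2[OF holomorphic_on_imp_continuous_on[OF Tinv_hol]])
      (auto intro!: continuous_on_snd continuous_on_id)
  show ?thesis
  proof (rule that, unfold_locales)
    show "t \<in> S" "r > 0" by fact+
    show "u_shift (axis j h) t \<in> S" if "h \<in> ball 0 r" for j h
      using inS axis that by blast
    show "continuous_on (cball 0 1 \<times> ball 0 r) (\<lambda>(w, h). X w (u_shift (axis j h) t) $ i $ k)" for i j k
      unfolding normalized_baker_entry case_prod_unfold M_eq
      by (intro continuous_on_sum continuous_on_mult Tinv_cont M_cont)
    show "(\<lambda>w. X w (u_shift (axis j h) t) $ i $ k) holomorphic_on ball 0 1" if "h \<in> ball 0 r" for i j k h
      unfolding normalized_baker_entry
      by (intro holomorphic_intros holw axis that)
    show "(\<lambda>h. X w (u_shift (axis j h) t) $ i $ k) holomorphic_on ball 0 r" if "w \<in> cball 0 1" for i j k w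
      unfolding normalized_baker_entry M_eq
      by (intro holomorphic_intros Tinv_hol M_holw that)
    have "\<tau> k a (u_shift (axis j h) t) = M j k a 0 h" for k a j h
      by (simp add: M_def time_minus_bracket_0)
    then show "(\<lambda>h. g (u_shift (axis j h) t) $ i $ k) holomorphic_on ball 0 r" for i j k
      unfolding G_matrix_entry by (auto intro!: holomorphic_intros Tinv_hol M_holw)
  qed
qed

context bkp
begin

lemma g_orthogonal:
  assumes t: "t \<in> S"
  shows "g t ** transpose (g t) = mat 1" "transpose (g t) ** g t = mat 1"
proof -
  obtain r where "bkp_slice S \<tau>0 \<tau> t r" by (rule slice_exists[OF t])
  then interpret bkp_slice S \<tau>0 \<tau> t r .
  have hol: "(\<lambda>w. X w t $ i $ k) holomorphic_on ball 0 1" for i k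
    using X_holw[of 0 _ i k] r by (simp add: u_shift_axis_0)
  have mean: "circle_mean (\<lambda>w. X w t $ i $ k * X (- w) t $ l $ k) = X 0 t $ i $ k * X (- 0) t $ l $ k" for i l k
  proof (rule circle_mean_holomorphic)
    show "continuous_on (cball 0 1) (\<lambda>w. X w t $ i $ k * X (- w) t $ l $ k)"
      by (intro continuous_on_mult continuous_X[OF t] continuous_on_reflect[OF continuous_X[OF t]])
    show "(\<lambda>w. X w t $ i $ k * X (- w) t $ l $ k) holomorphic_on ball 0 1"
      by (intro holomorphic_on_mult hol holomorphic_on_reflect[OF hol])
  qed
  have "(g t ** transpose (g t)) $ i $ l = mat 1 $ i $ l" for i l
    using bilinear[OF t t, of i l] by (simp add: mean X_0[OF t] mult_transpose_entry[symmetric] transpose_mat)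
  then show "g t ** transpose (g t) = mat 1"
    by (simp add: vec_eq_iff)
  then show "transpose (g t) ** g t = mat 1"
    by (simp add: matrix_left_right_inverse)
qed

end

section \<open>Differentiating the bilinear equation\<close>

context bkp_slice
begin

definition b :: "'n \<Rightarrow> 'n \<Rightarrow> complex" where
  "b i k = deriv (\<lambda>w. X w t $ i $ k) 0"

definition D :: "'n \<Rightarrow> 'n \<Rightarrow> 'n \<Rightarrow> complex \<Rightarrow> complex" where
  "D j i k w = deriv (\<lambda>h. X w (u_shift (axis j h) t) $ i $ k) 0"

definition dg :: "'n \<Rightarrow> 'n \<Rightarrow> 'n \<Rightarrow> complex" where
  "dg j i c = deriv (\<lambda>h. g (u_shift (axis j h) t) $ i $ c) 0"

text \<open>
  With \<open>w = 1/z\<close>, \<open>Y\<close> is the Baker matrix at the shifted time divided by \<open>\<psi>\<^sub>0\<close> at the base time.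
\<close>

definition Y :: "'n \<Rightarrow> 'n \<Rightarrow> 'n \<Rightarrow> complex \<Rightarrow> complex \<Rightarrow> complex" where
  "Y j i k w h = X w (u_shift (axis j h) t) $ i $ k * exp (if k = j then h / w else 0)"

definition dY :: "'n \<Rightarrow> 'n \<Rightarrow> 'n \<Rightarrow> complex \<Rightarrow> complex" where
  "dY j i k w = D j i k w + (if k = j then X w t $ i $ k / w else 0)"

lemma X_contt: "continuous_on (cball 0 1) (\<lambda>w. X w t $ i $ k)"
  by (rule continuous_X[OF t])

lemma X_holt: "(\<lambda>w. X w t $ i $ k) holomorphic_on ball 0 1"
  using X_holw[of 0 _ i k] r by (simp add: u_shift_axis_0)

lemma X_0t: "X 0 t $ i $ k = (if i = k then 1 else 0)"
  by (simp add: X_0[OF t] mat_def)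

lemma D_cont: "continuous_on (cball 0 1) (D j i k)"
  and D_hol: "D j i k holomorphic_on ball 0 1"
  and deriv_X_has_field_derivative:
    "((\<lambda>h. deriv (\<lambda>w. X w (u_shift (axis j h) t) $ i $ k) 0) has_field_derivative deriv (D j i k) 0) (at 0)"
  using deriv_holomorphic_family[OF r X_cont X_holw X_holh, of j i k] unfolding D_def[abs_def] by blast+

lemma has_field_derivative_at_0:
  assumes "f holomorphic_on ball 0 r"
  shows "(f has_field_derivative deriv f 0) (at 0)"
  using assms r by (intro holomorphic_derivI[of _ "ball 0 r"]) auto

lemma X_has_field_derivative:
  "w \<in> cball 0 1 \<Longrightarrow> ((\<lambda>h. X w (u_shift (axis j h) t) $ i $ k) has_field_derivative D j i k w) (at 0)"
  unfolding D_def by (intro has_field_derivative_at_0 X_holh)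

lemma g_has_field_derivative:
  "((\<lambda>h. g (u_shift (axis j h) t) $ i $ c) has_field_derivative dg j i c) (at 0)"
  unfolding dg_def by (intro has_field_derivative_at_0 g_hol)

lemma D_0: "D j i k 0 = 0"
proof -
  have "((\<lambda>h. mat 1 $ i $ k) has_field_derivative 0) (at (0::complex))"
    by (rule DERIV_const)
  then have "((\<lambda>h. X 0 (u_shift (axis j h) t) $ i $ k) has_field_derivative 0) (at 0)"
    by (rule has_field_derivative_transform_within_open[of _ _ _ "ball 0 r"])
      (use r X_0[OF shift_in_S] in auto)
  then show ?thesis unfolding D_def by (rule DERIV_imp_deriv)
qed

lemma Y_0: "Y j i k w 0 = X w t $ i $ k"
  by (simp add: Y_def u_shift_axis_0)

lemma Y_cont:
  "continuous_on (sphere 0 1 \<times> ball 0 r) (\<lambda>x. Y j i k (fst x) (snd x))"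
  "continuous_on (sphere 0 1 \<times> ball 0 r) (\<lambda>x. Y j i k (- fst x) (snd x))"
proof -
  have X: "continuous_on (cball 0 1 \<times> ball 0 r) (\<lambda>x. X (fst x) (u_shift (axis j (snd x)) t) $ i $ k)"
    using X_cont[of j i k] by (simp add: case_prod_unfold)
  have "continuous_on (sphere 0 1 \<times> ball 0 r) (\<lambda>x::complex \<times> complex. snd x / fst x)"
    by (intro continuous_on_divide continuous_on_fst continuous_on_snd continuous_on_id) auto
  then have "continuous_on (sphere 0 1 \<times> ball 0 r) (\<lambda>x::complex \<times> complex. exp (if k = j then snd x / fst x else 0))"
    by (intro continuous_on_exp) (cases "k = j"; simp)
  moreover have "continuous_on (sphere 0 1 \<times> ball 0 r) (\<lambda>x. X (fst x) (u_shift (axis j (snd x)) t) $ i $ k)"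
    by (rule continuous_on_subset[OF X]) auto
  ultimately show 1: "continuous_on (sphere 0 1 \<times> ball 0 r) (\<lambda>x. Y j i k (fst x) (snd x))"
    unfolding Y_def by (intro continuous_on_mult)
  have "continuous_on (sphere 0 1 \<times> ball 0 r) (\<lambda>x. (\<lambda>x. Y j i k (fst x) (snd x)) (- fst x, snd x))"
    by (rule continuous_on_compose2[OF 1])
      (auto intro!: continuous_on_Pair continuous_on_minus continuous_on_fst continuous_on_snd continuous_on_id)
  then show "continuous_on (sphere 0 1 \<times> ball 0 r) (\<lambda>x. Y j i k (- fst x) (snd x))"
    by simp
qed

lemma Y_hol:
  assumes "norm w = 1"
  shows "Y j i k w holomorphic_on ball 0 r"
proof -
  have "(\<lambda>h. exp (if k = j then h / w else 0)) holomorphic_on ball 0 r"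
    using assms by (cases "k = j") (auto intro!: holomorphic_intros)
  then show ?thesis
    unfolding Y_def using assms by (intro holomorphic_on_mult X_holh) auto
qed

lemma Y_has_field_derivative:
  assumes w: "w \<in> cball 0 1" "w \<noteq> 0"
  shows "(Y j i k w has_field_derivative dY j i k w) (at 0)"
proof -
  have "((\<lambda>h. exp (if k = j then h / w else 0)) has_field_derivative (if k = j then 1 / w else 0)) (at 0)"
    using w by (cases "k = j") (auto intro!: derivative_eq_intros)
  from DERIV_mult[OF X_has_field_derivative[OF w(1), of j i k] this] show ?thesis
    unfolding Y_def dY_def by (auto simp: u_shift_axis_0 elim!: DERIV_cong)
qed

lemma deriv_Y: "norm w = 1 \<Longrightarrow> deriv (Y j i k w) 0 = dY j i k w"
  by (intro DERIV_imp_deriv Y_has_field_derivative) auto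

lemma dY_cont:
  "continuous_on (sphere 0 1) (dY j i k)" "continuous_on (sphere 0 1) (\<lambda>w. dY j i k (- w))"
proof -
  have D: "continuous_on (sphere 0 1) (D j i k)"
    by (rule continuous_on_subset[OF D_cont]) auto
  have X: "continuous_on (sphere 0 1) (\<lambda>w. X w t $ i $ k)"
    by (rule continuous_on_subset[OF X_contt]) auto
  have "continuous_on (sphere 0 1) (\<lambda>w. X w t $ i $ k / w)"
    by (intro continuous_on_divide X continuous_on_id) auto
  then have "continuous_on (sphere 0 1) (\<lambda>w. if k = j then X w t $ i $ k / w else 0)"
    by (cases "k = j") simp_all
  with D show 1: "continuous_on (sphere 0 1) (dY j i k)"
    unfolding dY_def by (rule continuous_on_add)
  show "continuous_on (sphere 0 1) (\<lambda>w. dY j i k (- w))"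
    by (rule continuous_on_compose2[OF 1]) (auto intro!: continuous_intros)
qed

lemma bilinear_Y:
  assumes h: "h \<in> ball 0 r" and h': "h' \<in> ball 0 r"
  shows "(\<Sum>k\<in>UNIV. circle_mean (\<lambda>w. Y j i k w h * Y m l k (- w) h'))
    = (\<Sum>c\<in>UNIV. g (u_shift (axis j h) t) $ i $ c * g (u_shift (axis m h') t) $ l $ c)"
proof -
  have "(\<Sum>c\<in>UNIV. g (u_shift (axis j h) t) $ i $ c * g (u_shift (axis m h') t) $ l $ c) =
    (\<Sum>k\<in>UNIV. circle_mean (\<lambda>w. exp (xi (1 / w) (u_shift (axis j h) t k) - xi (1 / w) (u_shift (axis m h') t k)) *
      (X w (u_shift (axis j h) t) $ i $ k * X (- w) (u_shift (axis m h') t) $ l $ k)))"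
    using bilinear[OF shift_in_S[OF h] shift_in_S[OF h']] by (simp add: mult_transpose_entry)
  also have "\<dots> = (\<Sum>k\<in>UNIV. circle_mean (\<lambda>w. Y j i k w h * Y m l k (- w) h'))"
  proof (intro sum.cong refl circle_mean_cong)
    fix k and w :: complex
    have "xi (1 / w) (u_shift (axis j h) t k) - xi (1 / w) (u_shift (axis m h') t k)
        = (if k = j then h / w else 0) + (if k = m then h' / (- w) else 0)"
      using summable_xi[OF t, of "1 / w" k] by (simp add: xi_u_shift axis_def)
    then show "exp (xi (1 / w) (u_shift (axis j h) t k) - xi (1 / w) (u_shift (axis m h') t k)) *
      (X w (u_shift (axis j h) t) $ i $ k * X (- w) (u_shift (axis m h') t) $ l $ k) = Y j i k w h * Y m l k (- w) h'"
      by (simp only: Y_def exp_add mult_ac)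
  qed
  finally show ?thesis ..
qed

lemma bilinear_dY_Y:
  assumes h': "h' \<in> ball 0 r"
  shows "(\<Sum>k\<in>UNIV. circle_mean (\<lambda>w. dY j i k w * Y m l k (- w) h'))
    = (\<Sum>c\<in>UNIV. dg j i c * g (u_shift (axis m h') t) $ l $ c)"
proof -
  have Y': "continuous_on (sphere 0 1 \<times> ball 0 r) (\<lambda>x. Y m l k (- fst x) h')" for k
  proof -
    have "continuous_on (sphere 0 1 \<times> ball 0 r) (\<lambda>x. (\<lambda>x. Y m l k (- fst x) (snd x)) (fst x, h'))"
      by (rule continuous_on_compose2[OF Y_cont(2)])
        (use h' in \<open>auto intro!: continuous_on_Pair continuous_on_fst continuous_on_id continuous_on_const\<close>)
    then show ?thesis by simp
  qed
  have "((\<lambda>h. circle_mean (\<lambda>w. Y j i k w h * Y m l k (- w) h')) has_field_derivative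
      circle_mean (\<lambda>w. deriv (\<lambda>h. Y j i k w h * Y m l k (- w) h') 0)) (at 0)" for k
  proof (rule has_field_derivative_circle_mean[OF r])
    show "continuous_on (sphere 0 1 \<times> ball 0 r) (\<lambda>(w, h). Y j i k w h * Y m l k (- w) h')"
      unfolding case_prod_unfold by (intro continuous_on_mult Y_cont Y')
  qed (intro holomorphic_intros Y_hol)
  moreover have "circle_mean (\<lambda>w. deriv (\<lambda>h. Y j i k w h * Y m l k (- w) h') 0)
      = circle_mean (\<lambda>w. dY j i k w * Y m l k (- w) h')" for k
    by (intro circle_mean_cong DERIV_imp_deriv DERIV_cmult_right)
      (metis deriv_Y has_field_derivative_at_0 Y_hol)
  ultimately have 1: "((\<lambda>h. \<Sum>k\<in>UNIV. circle_mean (\<lambda>w. Y j i k w h * Y m l k (- w) h')) has_field_derivative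
      (\<Sum>k\<in>UNIV. circle_mean (\<lambda>w. dY j i k w * Y m l k (- w) h'))) (at 0)"
    by (intro DERIV_sum) simp
  have "((\<lambda>h. \<Sum>c\<in>UNIV. g (u_shift (axis j h) t) $ i $ c * g (u_shift (axis m h') t) $ l $ c) has_field_derivative
      (\<Sum>c\<in>UNIV. dg j i c * g (u_shift (axis m h') t) $ l $ c)) (at 0)"
    by (intro DERIV_sum DERIV_cmult_right g_has_field_derivative)
  then have "((\<lambda>h. \<Sum>k\<in>UNIV. circle_mean (\<lambda>w. Y j i k w h * Y m l k (- w) h')) has_field_derivative
      (\<Sum>c\<in>UNIV. dg j i c * g (u_shift (axis m h') t) $ l $ c)) (at 0)"
    by (rule has_field_derivative_transform_within_open[of _ _ _ "ball 0 r"])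
      (use r bilinear_Y[OF _ h'] in auto)
  with 1 show ?thesis by (rule DERIV_unique)
qed

lemma bilinear_dY_dY:
  "(\<Sum>k\<in>UNIV. circle_mean (\<lambda>w. dY j i k w * dY m l k (- w))) = (\<Sum>c\<in>UNIV. dg j i c * dg m l c)"
proof -
  have dY': "continuous_on (sphere 0 1 \<times> ball 0 r) (\<lambda>x. dY j i k (fst x))" for k
    by (rule continuous_on_compose2[OF dY_cont(1)]) (auto intro!: continuous_intros)
  have "((\<lambda>h. circle_mean (\<lambda>w. dY j i k w * Y m l k (- w) h)) has_field_derivative
      circle_mean (\<lambda>w. deriv (\<lambda>h. dY j i k w * Y m l k (- w) h) 0)) (at 0)" for k
  proof (rule has_field_derivative_circle_mean[OF r])
    show "continuous_on (sphere 0 1 \<times> ball 0 r) (\<lambda>(w, h). dY j i k w * Y m l k (- w) h)"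
      unfolding case_prod_unfold by (intro continuous_on_mult Y_cont dY')
  qed (intro holomorphic_intros Y_hol, simp)
  moreover have "circle_mean (\<lambda>w. deriv (\<lambda>h. dY j i k w * Y m l k (- w) h) 0)
      = circle_mean (\<lambda>w. dY j i k w * dY m l k (- w))" for k
  proof (intro circle_mean_cong DERIV_imp_deriv DERIV_cmult)
    fix w :: complex assume "norm w = 1"
    then have w: "norm (- w) = 1" by simp
    show "(Y m l k (- w) has_field_derivative dY m l k (- w)) (at 0)"
      using has_field_derivative_at_0[OF Y_hol[OF w]] deriv_Y[OF w] by simp
  qed
  ultimately have 1: "((\<lambda>h. \<Sum>k\<in>UNIV. circle_mean (\<lambda>w. dY j i k w * Y m l k (- w) h)) has_field_derivative
      (\<Sum>k\<in>UNIV. circle_mean (\<lambda>w. dY j i k w * dY m l k (- w)))) (at 0)"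
    by (intro DERIV_sum) simp
  have "((\<lambda>h. \<Sum>c\<in>UNIV. dg j i c * g (u_shift (axis m h) t) $ l $ c) has_field_derivative
      (\<Sum>c\<in>UNIV. dg j i c * dg m l c)) (at 0)"
    by (intro DERIV_sum DERIV_cmult g_has_field_derivative)
  then have "((\<lambda>h. \<Sum>k\<in>UNIV. circle_mean (\<lambda>w. dY j i k w * Y m l k (- w) h)) has_field_derivative
      (\<Sum>c\<in>UNIV. dg j i c * dg m l c)) (at 0)"
    by (rule has_field_derivative_transform_within_open[of _ _ _ "ball 0 r"])
      (use r bilinear_dY_Y in auto)
  with 1 show ?thesis by (rule DERIV_unique)
qed

end

section \<open>Linear equations for the rows\<close>

context bkp_slice
begin

lemma g_orthonormal: "(\<Sum>c\<in>UNIV. g t $ i $ c * g t $ l $ c) = (if i = l then 1 else 0)"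
proof -
  have "(g t ** transpose (g t)) $ i $ l = mat 1 $ i $ l"
    by (simp only: g_orthogonal(1)[OF t])
  then show ?thesis by (simp add: mult_transpose_entry mat_def)
qed

lemma g_expansion: "v c = (\<Sum>l\<in>UNIV. (\<Sum>e\<in>UNIV. v e * g t $ l $ e) * g t $ l $ c)"
proof -
  have *: "(\<Sum>l\<in>UNIV. g t $ l $ e * g t $ l $ c) = (if e = c then 1 else 0)" for e
  proof -
    have "(transpose (g t) ** g t) $ e $ c = mat 1 $ e $ c"
      by (simp only: g_orthogonal(2)[OF t])
    then show ?thesis by (simp add: matrix_matrix_mult_def transpose_def mat_def)
  qed
  have "(\<Sum>l\<in>UNIV. (\<Sum>e\<in>UNIV. v e * g t $ l $ e) * g t $ l $ c) =
      (\<Sum>l\<in>UNIV. \<Sum>e\<in>UNIV. v e * (g t $ l $ e * g t $ l $ c))"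
    by (simp add: sum_distrib_right mult.assoc)
  also have "\<dots> = (\<Sum>e\<in>UNIV. v e * (\<Sum>l\<in>UNIV. g t $ l $ e * g t $ l $ c))"
    by (subst sum.swap) (simp add: sum_distrib_left)
  also have "\<dots> = v c" by (simp add: * if_distrib cong: if_cong)
  finally show ?thesis ..
qed

definition residual :: "'n \<Rightarrow> 'n \<Rightarrow> 'n \<Rightarrow> complex \<Rightarrow> complex" where
  "residual i j k w = D j i k w +
     (if k = j then if w = 0 then b i j else X w t $ i $ j / w else 0) - b i j * X w t $ j $ k"

lemma
  assumes "i \<noteq> j"
  shows residual_cont: "continuous_on (cball 0 1) (residual i j k)"
    and residual_hol: "residual i j k holomorphic_on ball 0 1"
    and residual_0: "residual i j k 0 = 0"
proof -
  have 0: "X 0 t $ i $ j = 0" using assms by (simp add: X_0t)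
  have q: "continuous_on (cball 0 1) (\<lambda>w. if w = 0 then b i j else X w t $ i $ j / w)"
    using removable_quotient(1)[OF X_contt[of i j] X_holt] unfolding 0 b_def diff_zero .
  have q_hol: "(\<lambda>w. if w = 0 then b i j else X w t $ i $ j / w) holomorphic_on ball 0 1"
    using removable_quotient(2)[OF X_contt[of i j] X_holt] unfolding 0 b_def diff_zero .
  have q': "continuous_on (cball 0 1) (\<lambda>w. if k = j then if w = 0 then b i j else X w t $ i $ j / w else 0)"
    "(\<lambda>w. if k = j then if w = 0 then b i j else X w t $ i $ j / w else 0) holomorphic_on ball 0 1"
    using q q_hol by (cases "k = j"; simp)+
  show "continuous_on (cball 0 1) (residual i j k)"
    unfolding residual_def
    by (intro continuous_on_diff continuous_on_add D_cont q' continuous_on_mult continuous_on_const X_contt)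
  show "residual i j k holomorphic_on ball 0 1"
    unfolding residual_def
    by (intro holomorphic_on_diff holomorphic_on_add D_hol q' holomorphic_on_mult holomorphic_on_const X_holt)
  show "residual i j k 0 = 0"
    by (simp add: residual_def D_0 X_0t)
qed

lemma bilinear_residual:
  assumes ij: "i \<noteq> j" and h: "h \<in> ball 0 r"
  shows "(\<Sum>k\<in>UNIV. circle_mean (\<lambda>w. residual i j k w * Y m l k (- w) h))
    = (\<Sum>c\<in>UNIV. (dg j i c - b i j * g t $ j $ c) * g (u_shift (axis m h) t) $ l $ c)"
proof -
  have Y': "continuous_on (sphere 0 1) (\<lambda>w. Y m l k (- w) h)" for k
  proof -
    have "continuous_on (sphere 0 1) (\<lambda>w. (\<lambda>x. Y m l k (- fst x) (snd x)) (w, h))"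
      by (rule continuous_on_compose2[OF Y_cont(2)])
        (use h in \<open>auto intro!: continuous_on_Pair continuous_on_id continuous_on_const\<close>)
    then show ?thesis by simp
  qed
  have X: "continuous_on (sphere 0 1) (\<lambda>w. X w t $ j $ k)" for k
    by (rule continuous_on_subset[OF X_contt]) auto
  have "circle_mean (\<lambda>w. residual i j k w * Y m l k (- w) h) =
      circle_mean (\<lambda>w. dY j i k w * Y m l k (- w) h) - b i j * circle_mean (\<lambda>w. Y j j k w 0 * Y m l k (- w) h)"
    (is "?L = ?R") for k
  proof -
    have "?L = circle_mean (\<lambda>w. dY j i k w * Y m l k (- w) h - b i j * (Y j j k w 0 * Y m l k (- w) h))"
    proof (rule circle_mean_cong)
      fix w :: complex assume "norm w = 1"
      then have "w \<noteq> 0" by auto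
      then have eq: "residual i j k w = dY j i k w - b i j * Y j j k w 0"
        by (simp add: residual_def dY_def Y_0)
      show "residual i j k w * Y m l k (- w) h = dY j i k w * Y m l k (- w) h - b i j * (Y j j k w 0 * Y m l k (- w) h)"
        unfolding eq by (simp only: left_diff_distrib mult.assoc)
    qed
    also have "\<dots> = ?R"
      unfolding circle_mean_cmult[symmetric] Y_0
      by (intro circle_mean_diff continuous_on_mult continuous_on_const dY_cont Y' X)
    finally show ?thesis .
  qed
  then have "(\<Sum>k\<in>UNIV. circle_mean (\<lambda>w. residual i j k w * Y m l k (- w) h)) =
      (\<Sum>k\<in>UNIV. circle_mean (\<lambda>w. dY j i k w * Y m l k (- w) h)) -
      b i j * (\<Sum>k\<in>UNIV. circle_mean (\<lambda>w. Y j j k w 0 * Y m l k (- w) h))"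
    by (simp add: sum_subtractf sum_distrib_left)
  also have "\<dots> = (\<Sum>c\<in>UNIV. (dg j i c - b i j * g t $ j $ c) * g (u_shift (axis m h) t) $ l $ c)"
    using h r
    by (simp add: bilinear_dY_Y bilinear_Y u_shift_axis_0 sum_distrib_left algebra_simps flip: sum_subtractf)
  finally show ?thesis .
qed

lemma circle_mean_residual_X:
  assumes ij: "i \<noteq> j" and h: "h \<in> ball 0 r"
  shows "circle_mean (\<lambda>w. residual i j k w * X (- w) (u_shift (axis m h) t) $ l $ k) = 0"
proof -
  have X: "continuous_on (cball 0 1) (\<lambda>w. X w (u_shift (axis m h) t) $ l $ k)"
    by (rule continuous_X[OF shift_in_S[OF h]])
  have "circle_mean (\<lambda>w. residual i j k w * X (- w) (u_shift (axis m h) t) $ l $ k)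
      = residual i j k 0 * X (- 0) (u_shift (axis m h) t) $ l $ k"
    by (intro circle_mean_holomorphic continuous_on_mult holomorphic_on_mult residual_cont residual_hol ij
        continuous_on_reflect[OF X] holomorphic_on_reflect[OF X_holw[OF h]])
  then show ?thesis by (simp add: residual_0[OF ij])
qed

lemma dg_off_diagonal:
  assumes ij: "i \<noteq> j"
  shows "dg j i c = b i j * g t $ j $ c"
proof -
  have 0: "0 \<in> ball (0::complex) r" using r by simp
  have "(\<Sum>e\<in>UNIV. (dg j i e - b i j * g t $ j $ e) * g t $ l $ e) = 0" for l
    using bilinear_residual[OF ij 0, of j l] circle_mean_residual_X[OF ij 0, of _ j l]
    by (simp add: Y_0 u_shift_axis_0)
  then have "dg j i c - b i j * g t $ j $ c = 0"
    by (subst g_expansion[of "\<lambda>e. dg j i e - b i j * g t $ j $ e"]) simp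
  then show ?thesis by simp
qed

text \<open>
  The residual pairs to zero with all Baker matrices at nearby times.  Shifting only \<open>u_k\<close>
  isolates its \<open>k\<close>-th entry and multiplies it by \<open>exp (- h / w)\<close>.
\<close>

lemma residual_eq_0:
  assumes ij: "i \<noteq> j" and w: "w \<in> cball 0 1"
  shows "residual i j k w = 0"
proof (rule eq_0_if_circle_mean_exp_eq_0[where f = "residual i j k" and w = w and r = r and a = "\<lambda>w h. X (- w) (u_shift (axis k h) t) $ k $ k"])
  have X: "continuous_on (cball 0 1 \<times> ball 0 r) (\<lambda>x. X (fst x) (u_shift (axis k (snd x)) t) $ k $ k)"
    using X_cont[of k k k] by (simp add: case_prod_unfold)
  have "continuous_on (cball 0 1 \<times> ball 0 r)
      (\<lambda>x. (\<lambda>x. X (fst x) (u_shift (axis k (snd x)) t) $ k $ k) (- fst x, snd x))"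
    by (rule continuous_on_compose2[OF X])
      (auto intro!: continuous_on_Pair continuous_on_minus continuous_on_fst continuous_on_snd continuous_on_id)
  then show "continuous_on (cball 0 1 \<times> ball 0 r) (\<lambda>(w, h). X (- w) (u_shift (axis k h) t) $ k $ k)"
    by (simp add: case_prod_unfold)
  show "circle_mean (\<lambda>w. residual i j k w * X (- w) (u_shift (axis k h) t) $ k $ k * exp (- (h / w))) = 0"
    if h: "h \<in> ball 0 r" for h
  proof -
    have "0 = (\<Sum>m\<in>UNIV. circle_mean (\<lambda>w. residual i j m w * Y k k m (- w) h))"
      by (simp add: bilinear_residual[OF ij h] dg_off_diagonal[OF ij])
    also have "\<dots> = (\<Sum>m\<in>{k}. circle_mean (\<lambda>w. residual i j m w * Y k k m (- w) h))"
    proof (rule sum.mono_neutral_right)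
      show "\<forall>m\<in>UNIV - {k}. circle_mean (\<lambda>w. residual i j m w * Y k k m (- w) h) = 0"
        using circle_mean_residual_X[OF ij h, of _ k k] by (auto simp: Y_def)
    qed auto
    also have "\<dots> = circle_mean (\<lambda>w. residual i j k w * X (- w) (u_shift (axis k h) t) $ k $ k * exp (- (h / w)))"
      by (simp add: Y_def mult.assoc)
    finally show ?thesis ..
  qed
  have "X 0 (u_shift (axis k h) t) $ k $ k = 1" if "h \<in> ball 0 r" for h
    using X_0[OF shift_in_S[OF that]] by (simp add: mat_def)
  then show "X (- 0) (u_shift (axis k h) t) $ k $ k = 1" if "h \<in> ball 0 r" for h
    using that by simp
qed (use r w residual_cont[OF ij] residual_hol[OF ij] holomorphic_on_reflect[OF X_holw] in auto)

lemma D_off_diagonal: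
  assumes "i \<noteq> j" "w \<in> cball 0 1" "w \<noteq> 0"
  shows "dY j i k w = b i j * X w t $ j $ k"
  using residual_eq_0[OF assms(1,2), of k] assms(3) by (simp add: residual_def dY_def split: if_splits)

lemma dg_dot_g:
  "(\<Sum>c\<in>UNIV. dg i i c * g t $ l $ c) = (if l = i then 0 else - b l i)"
proof -
  have "((\<lambda>h. \<Sum>c\<in>UNIV. g (u_shift (axis i h) t) $ i $ c * g (u_shift (axis i h) t) $ l $ c) has_field_derivative
      (\<Sum>c\<in>UNIV. g t $ i $ c * dg i l c + dg i i c * g t $ l $ c)) (at 0)"
    using DERIV_mult'[OF g_has_field_derivative[of i i] g_has_field_derivative[of i l]]
    by (intro DERIV_sum) (simp add: u_shift_axis_0)
  moreover have "((\<lambda>h. \<Sum>c\<in>UNIV. g (u_shift (axis i h) t) $ i $ c * g (u_shift (axis i h) t) $ l $ c)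
      has_field_derivative 0) (at 0)"
  proof (rule has_field_derivative_transform_within_open[of _ _ _ "ball 0 r"])
    show "((\<lambda>h. mat 1 $ i $ l) has_field_derivative 0) (at (0::complex))" by (rule DERIV_const)
    show "mat 1 $ i $ l = (\<Sum>c\<in>UNIV. g (u_shift (axis i h) t) $ i $ c * g (u_shift (axis i h) t) $ l $ c)"
      if "h \<in> ball 0 r" for h
      using g_orthogonal(1)[OF shift_in_S[OF that]] by (simp add: mult_transpose_entry[symmetric])
  qed (use r in auto)
  ultimately have "(\<Sum>c\<in>UNIV. g t $ i $ c * dg i l c + dg i i c * g t $ l $ c) = 0"
    by (rule DERIV_unique)
  then have sum: "(\<Sum>c\<in>UNIV. dg i i c * g t $ l $ c) = - (\<Sum>c\<in>UNIV. g t $ i $ c * dg i l c)"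
    by (simp add: sum.distrib eq_neg_iff_add_eq_0 add.commute)
  show ?thesis
  proof (cases "l = i")
    case True
    have "(\<Sum>c\<in>UNIV. g t $ i $ c * dg i i c) = (\<Sum>c\<in>UNIV. dg i i c * g t $ i $ c)"
      by (simp add: mult.commute)
    then show ?thesis using sum True by simp
  next
    case False
    have "(\<Sum>c\<in>UNIV. g t $ i $ c * dg i l c) = b l i * (\<Sum>c\<in>UNIV. g t $ i $ c * g t $ i $ c)"
      by (simp add: dg_off_diagonal[OF False] sum_distrib_left mult_ac)
    also have "\<dots> = b l i" by (simp add: g_orthonormal)
    finally show ?thesis using sum False by simp
  qed
qed

lemma dg_diagonal: "dg i i c = - (\<Sum>l\<in>UNIV - {i}. b l i * g t $ l $ c)"
proof -
  have "dg i i c = (\<Sum>l\<in>UNIV. (if l = i then 0 else - b l i) * g t $ l $ c)"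
    using g_expansion[of "dg i i" c] by (simp add: dg_dot_g)
  also have "\<dots> = (\<Sum>l\<in>UNIV - {i}. - (b l i * g t $ l $ c))"
    by (rule sum.mono_neutral_cong_right) auto
  finally show ?thesis by (simp add: sum_negf)
qed

lemma dg_dot_dg:
  assumes "i \<noteq> j"
  shows "(\<Sum>c\<in>UNIV. dg i i c * dg j j c) = (\<Sum>k\<in>UNIV - {i, j}. b k i * b k j)"
proof -
  have "(\<Sum>c\<in>UNIV. dg i i c * dg j j c) = - (\<Sum>c\<in>UNIV. \<Sum>l\<in>UNIV - {j}. b l j * (dg i i c * g t $ l $ c))"
    by (simp add: dg_diagonal[of j] sum_distrib_left mult_ac sum_negf)
  also have "\<dots> = - (\<Sum>l\<in>UNIV - {j}. b l j * (\<Sum>c\<in>UNIV. dg i i c * g t $ l $ c))"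
    by (subst sum.swap) (simp add: sum_distrib_left)
  also have "\<dots> = (\<Sum>l\<in>UNIV - {j}. if l = i then 0 else b l i * b l j)"
    by (simp add: dg_dot_g sum_negf[symmetric] if_distrib mult.commute cong: if_cong)
  also have "\<dots> = (\<Sum>k\<in>UNIV - {i, j}. b k i * b k j)"
    by (rule sum.mono_neutral_cong_right) auto
  finally show ?thesis .
qed

lemma Lame_1:
  assumes "i \<noteq> k" "j \<noteq> k"
  shows "deriv (D k i j) 0 = b i k * b k j"
proof -
  have "D k i j w = b i k * X w t $ k $ j" if "w \<in> ball 0 1" for w
    using residual_eq_0[OF assms(1), of w j] assms(2) that by (simp add: residual_def)
  then have "deriv (D k i j) 0 = deriv (\<lambda>w. b i k * X w t $ k $ j) 0"
    by (intro deriv_cong_ev eventually_nhds_in_open[THEN eventually_mono, of "ball 0 1"]) auto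
  also have "\<dots> = b i k * b k j"
    unfolding b_def[of k j]
    by (intro deriv_cmult holomorphic_on_imp_differentiable_at[OF X_holt]) auto
  finally show ?thesis .
qed

lemma Lame_2:
  assumes ij: "i \<noteq> j"
  shows "deriv (D i i j) 0 + deriv (D j j i) 0 + (\<Sum>k\<in>UNIV - {i, j}. b k i * b k j) = 0"
proof -
  define Q where "Q = (\<lambda>j i k w. if w = 0 then deriv (D j i k) 0 else (D j i k w - D j i k 0) / w)"
  have Q: "continuous_on (cball 0 1) (Q j i k)" "Q j i k holomorphic_on ball 0 1" for j i k
    unfolding Q_def by (rule removable_quotient[OF D_cont D_hol])+
  have DQ: "D j i k w = w * Q j i k w" for j i k w
    by (simp add: Q_def D_0)
  have mean: "circle_mean (\<lambda>w. u w * v (- w)) = u 0 * v 0"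
    if "continuous_on (cball 0 1) u" "u holomorphic_on ball 0 1"
       "continuous_on (cball 0 1) v" "v holomorphic_on ball 0 1" for u v
    using circle_mean_holomorphic[of "\<lambda>w. u w * v (- w)"] that
    by (simp add: continuous_on_mult holomorphic_on_mult continuous_on_reflect holomorphic_on_reflect)
  define P where "P = (\<lambda>j w. w * D j j j w + X w t $ j $ j)"
  have P: "continuous_on (cball 0 1) (P j)" "P j holomorphic_on ball 0 1" "P j 0 = 1" for j
    unfolding P_def
    by (intro continuous_on_add continuous_on_mult continuous_on_id D_cont X_contt)
      (intro holomorphic_on_add holomorphic_on_mult holomorphic_on_ident D_hol X_holt, simp add: X_0t)
  have "circle_mean (\<lambda>w. dY i i k w * dY j j k (- w)) =
    (if k = i then - deriv (D j j i) 0 else if k = j then - deriv (D i i j) 0 else 0)" for k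
  proof -
    consider "k = i" | "k = j" "k \<noteq> i" | "k \<noteq> i" "k \<noteq> j" by blast
    then show ?thesis
    proof cases
      case 1
      have "circle_mean (\<lambda>w. dY i i k w * dY j j k (- w)) = circle_mean (\<lambda>w. - 1 * (P i w * Q j j i (- w)))"
      proof (rule circle_mean_cong)
        fix w :: complex assume "norm w = 1"
        then have "w \<noteq> 0" by auto
        then show "dY i i k w * dY j j k (- w) = - 1 * (P i w * Q j j i (- w))"
          using 1 ij by (simp add: dY_def DQ[of j j i "- w"] P_def field_simps)
      qed
      also have "\<dots> = - 1 * (P i 0 * Q j j i 0)"
        unfolding circle_mean_cmult by (subst mean[OF P(1,2) Q]) simp
      finally show ?thesis using 1 by (simp add: P Q_def)
    next
      case 2
      have "circle_mean (\<lambda>w. dY i i k w * dY j j k (- w)) = circle_mean (\<lambda>w. - 1 * (Q i i j w * P j (- w)))"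
      proof (rule circle_mean_cong)
        fix w :: complex assume "norm w = 1"
        then have "w \<noteq> 0" by auto
        then show "dY i i k w * dY j j k (- w) = - 1 * (Q i i j w * P j (- w))"
          using 2 ij by (simp add: dY_def DQ[of i i j w] P_def field_simps)
      qed
      also have "\<dots> = - 1 * (Q i i j 0 * P j 0)"
        unfolding circle_mean_cmult by (subst mean[OF Q P(1,2)]) simp
      finally show ?thesis using 2 by (simp add: P Q_def)
    next
      case 3
      then show ?thesis
        using mean[OF D_cont D_hol D_cont D_hol, of i i k j j k] by (simp add: dY_def D_0)
    qed
  qed
  then have "(\<Sum>k\<in>UNIV. circle_mean (\<lambda>w. dY i i k w * dY j j k (- w))) =
    (\<Sum>k\<in>UNIV. (if k = i then - deriv (D j j i) 0 else 0) + (if k = j then - deriv (D i i j) 0 else 0))"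
    using ij by (intro sum.cong) auto
  also have "\<dots> = - deriv (D j j i) 0 - deriv (D i i j) 0"
    by (simp add: sum.distrib)
  finally have "(\<Sum>k\<in>UNIV - {i, j}. b k i * b k j) = - deriv (D j j i) 0 - deriv (D i i j) 0"
    using bilinear_dY_dY[of i i j j] dg_dot_dg[OF ij] by simp
  then show ?thesis by simp
qed

end

lemma u_deriv_eqI:
  assumes "((\<lambda>h. F (u_shift (axis j h) t)) has_field_derivative d) (at 0)"
  shows "u_differentiable j F t" "u_deriv j F t = d"
  using assms unfolding u_differentiable_def u_deriv_def
  by (auto simp: field_differentiable_def intro: DERIV_imp_deriv)

lemma u_deriv_vec_eqI:
  assumes "\<And>l. ((\<lambda>h. F (u_shift (axis j h) t) $ l) has_field_derivative v $ l) (at 0)"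
  shows "u_differentiable_vec j F t" "u_deriv_vec j F t = v"
  using u_deriv_eqI[of "\<lambda>t. F t $ _", OF assms]
  by (auto simp: u_differentiable_vec_def u_deriv_vec_def vec_eq_iff)

lemma (in bkp) beta_eq_deriv:
  assumes beta: "beta_coefficient S \<tau> \<beta>" and t: "t \<in> S"
  shows "\<beta> t $ i $ j = deriv (\<lambda>w. X w t $ i $ j) 0"
proof -
  have "(\<lambda>z. X (1 / z) t $ i $ j - mat 1 $ i $ j - \<beta> t $ i $ j / z) \<in> O[at_infinity](\<lambda>z. 1 / z ^ 2)"
    using beta t unfolding beta_coefficient_def chi_matrix_eq by blast
  then obtain c where
    "\<forall>\<^sub>F z in at_infinity. norm (X (1 / z) t $ i $ j - mat 1 $ i $ j - \<beta> t $ i $ j / z) \<le> c * norm (1 / z ^ 2)"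
    by (elim landau_o.bigE)
  then have "\<forall>\<^sub>F w in at 0. norm (X (1 / inverse w) t $ i $ j - mat 1 $ i $ j - \<beta> t $ i $ j / inverse w) \<le> c * norm (1 / inverse w ^ 2)"
    by (rule eventually_compose_filterlim) (rule filterlim_inverse_at_infinity)
  moreover have "\<forall>\<^sub>F w in at (0::complex). w \<noteq> 0"
    by (simp add: eventually_at_filter)
  ultimately have ev: "\<forall>\<^sub>F w in at 0. norm ((X w t $ i $ j - X 0 t $ i $ j) / (w - 0) - \<beta> t $ i $ j) \<le> c * norm w"
  proof eventually_elim
    case (elim w)
    have eq: "(X w t $ i $ j - X 0 t $ i $ j) / (w - 0) - \<beta> t $ i $ j =
        (X w t $ i $ j - mat 1 $ i $ j - \<beta> t $ i $ j * w) / w"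
      using elim(2) by (simp add: X_0[OF t] diff_divide_distrib)
    have "norm (X w t $ i $ j - mat 1 $ i $ j - \<beta> t $ i $ j * w) \<le> c * norm w * norm w"
      using elim(1) by (simp add: divide_inverse norm_mult power2_eq_square mult.assoc)
    then show ?case
      unfolding eq norm_divide using elim(2) by (simp add: divide_le_eq)
  qed
  have lim: "((\<lambda>w::complex. c * norm w) \<longlongrightarrow> 0) (at 0)"
    by (intro tendsto_mult_right_zero tendsto_norm_zero tendsto_ident_at)
  have "((\<lambda>w. (X w t $ i $ j - X 0 t $ i $ j) / (w - 0) - \<beta> t $ i $ j) \<longlongrightarrow> 0) (at 0)"
    by (rule Lim_null_comparison[OF ev lim])
  then have "((\<lambda>w. X w t $ i $ j) has_field_derivative \<beta> t $ i $ j) (at 0)"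
    unfolding has_field_derivative_iff by (rule LIM_zero_cancel)
  then show ?thesis by (simp add: DERIV_imp_deriv)
qed

context bkp_slice
begin

lemma beta_eq_b:
  assumes "beta_coefficient S \<tau> \<beta>"
  shows "\<beta> t $ i $ j = b i j"
  unfolding b_def by (rule beta_eq_deriv[OF assms t])

lemma beta_has_field_derivative:
  assumes beta: "beta_coefficient S \<tau> \<beta>"
  shows "((\<lambda>h. \<beta> (u_shift (axis k h) t) $ i $ j) has_field_derivative deriv (D k i j) 0) (at 0)"
  by (rule has_field_derivative_transform_within_open[OF deriv_X_has_field_derivative open_ball[of 0 r]])
    (use r beta_eq_deriv[OF beta shift_in_S] in auto)

lemma G_has_field_derivative:
  assumes adm: "admissible_G S \<tau> G"
  shows "((\<lambda>h. G (u_shift (axis j h) t) $ i $ c) has_field_derivative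
    (\<Sum>l\<in>UNIV. (\<Sum>e\<in>UNIV. dg j i e * g t $ l $ e) * G t $ l $ c)) (at 0)"
proof -
  have "G t ** transpose (G t) = mat 1"
    using adm t g_orthogonal(1)[OF t] unfolding admissible_G_def by simp
  then have orth: "transpose (G t) ** G t = mat 1"
    by (simp add: matrix_left_right_inverse)
  have G: "(\<Sum>l\<in>UNIV. (\<Sum>e\<in>UNIV. g (u_shift (axis j h) t) $ i $ e * g t $ l $ e) * G t $ l $ c)
      = G (u_shift (axis j h) t) $ i $ c" if h: "h \<in> ball 0 r" for h
  proof -
    let ?s = "u_shift (axis j h) t"
    have "G ?s = G ?s ** (transpose (G t) ** G t)"
      by (simp add: orth)
    also have "\<dots> = (g ?s ** transpose (g t)) ** G t"
      using adm t shift_in_S[OF h] unfolding admissible_G_def by (simp add: matrix_mul_assoc)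
    finally have "G ?s $ i $ c = ((g ?s ** transpose (g t)) ** G t) $ i $ c"
      by simp
    also have "\<dots> = (\<Sum>l\<in>UNIV. (g ?s ** transpose (g t)) $ i $ l * G t $ l $ c)"
      by (simp add: matrix_matrix_mult_def)
    finally show ?thesis by (simp only: mult_transpose_entry)
  qed
  have "((\<lambda>h. \<Sum>l\<in>UNIV. (\<Sum>e\<in>UNIV. g (u_shift (axis j h) t) $ i $ e * g t $ l $ e) * G t $ l $ c)
      has_field_derivative (\<Sum>l\<in>UNIV. (\<Sum>e\<in>UNIV. dg j i e * g t $ l $ e) * G t $ l $ c)) (at 0)"
    by (intro DERIV_sum DERIV_cmult_right g_has_field_derivative)
  then show ?thesis
    by (rule has_field_derivative_transform_within_open[OF _ open_ball[of 0 r]]) (use r G in auto)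
qed

lemma G_off_diagonal:
  assumes adm: "admissible_G S \<tau> G" and ij: "i \<noteq> j"
  shows "((\<lambda>h. G (u_shift (axis j h) t) $ i $ c) has_field_derivative b i j * G t $ j $ c) (at 0)"
proof -
  have "(\<Sum>e\<in>UNIV. dg j i e * g t $ l $ e) = (if j = l then b i j else 0)" for l
    using g_orthonormal[of j l]
    by (simp add: dg_off_diagonal[OF ij] mult.assoc flip: sum_distrib_left)
  then have "(\<Sum>l\<in>UNIV. (\<Sum>e\<in>UNIV. dg j i e * g t $ l $ e) * G t $ l $ c) = (\<Sum>l\<in>UNIV. if j = l then b i j * G t $ l $ c else 0)"
    by (intro sum.cong) auto
  also have "\<dots> = b i j * G t $ j $ c" by simp
  finally show ?thesis using G_has_field_derivative[OF adm, of j i c] by simp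
qed

lemma G_diagonal:
  assumes adm: "admissible_G S \<tau> G"
  shows "((\<lambda>h. G (u_shift (axis i h) t) $ i $ c) has_field_derivative
    - (\<Sum>l\<in>UNIV - {i}. b l i * G t $ l $ c)) (at 0)"
proof -
  have "(\<Sum>l\<in>UNIV. (\<Sum>e\<in>UNIV. dg i i e * g t $ l $ e) * G t $ l $ c)
      = (\<Sum>l\<in>UNIV - {i}. - (b l i * G t $ l $ c))"
    by (rule sum.mono_neutral_cong_right) (auto simp: dg_dot_g)
  then show ?thesis using G_has_field_derivative[OF adm, of i i c] by (simp add: sum_negf)
qed

lemma baker_matrix_shift:
  assumes "z \<noteq> 0"
  shows "baker_matrix \<tau> z (u_shift (axis j h) t) $ i $ k = Y j i k (1 / z) h * exp (xi z (t k))"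
proof -
  have "xi z (u_shift (axis j h) t k) = (if k = j then h / (1 / z) else 0) + xi z (t k)"
    using summable_xi[OF t, of z k] by (simp add: xi_u_shift axis_def)
  then show ?thesis
    by (simp add: baker_matrix_entry Y_def exp_add)
qed

lemma baker_has_field_derivative:
  assumes ij: "i \<noteq> j" and z: "norm z \<ge> 1"
  shows "((\<lambda>h. baker_matrix \<tau> z (u_shift (axis j h) t) $ i $ k) has_field_derivative
    b i j * baker_matrix \<tau> z t $ j $ k) (at 0)"
proof -
  have z0: "z \<noteq> 0" using z by auto
  have w: "1 / z \<in> cball 0 1" "1 / z \<noteq> 0"
    using z z0 by (auto simp: norm_divide)
  have "dY j i k (1 / z) * exp (xi z (t k)) = b i j * baker_matrix \<tau> z t $ j $ k"
    by (simp add: D_off_diagonal[OF ij w] baker_matrix_entry)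
  then show ?thesis
    unfolding baker_matrix_shift[OF z0]
    using DERIV_cmult_right[OF Y_has_field_derivative[OF w, of j i k], of "exp (xi z (t k))"] by simp
qed

lemma continued_baker_has_field_derivative:
  assumes mero: "baker_meromorphic_inside S \<tau> Z \<Psi>" and z: "z \<notin> Z" and ij: "i \<noteq> j"
  shows "((\<lambda>h. \<Psi> z (u_shift (axis j h) t) $ i $ k) has_field_derivative b i j * \<Psi> z t $ j $ k) (at 0)"
proof -
  have Z: "finite Z" "Z \<subseteq> ball 0 1 - {0}"
    using mero unfolding baker_meromorphic_inside_def by auto
  have \<Psi>: "\<And>z. norm z \<ge> 1 \<Longrightarrow> \<Psi> z s = baker_matrix \<tau> z s"
    "\<And>i k. (\<lambda>z. \<Psi> z s $ i $ k) meromorphic_on ball 0 1"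
    "\<And>i k. (\<lambda>z. \<Psi> z s $ i $ k) holomorphic_on ball 0 1 - Z"
    "\<And>i k. continuous_on (cball 0 1 - Z) (\<lambda>z. \<Psi> z s $ i $ k)" if "s \<in> S" for s
    using mero that unfolding baker_meromorphic_inside_def by blast+
  have outer: "((\<lambda>h. \<Psi> z (u_shift (axis j h) t) $ i $ k) has_field_derivative b i j * \<Psi> z t $ j $ k) (at 0)"
    if "norm z \<ge> 1" for z
    unfolding \<Psi>(1)[OF t that]
    by (rule has_field_derivative_transform_within_open[OF baker_has_field_derivative[OF ij that] open_ball[of 0 r]])
      (use r \<Psi>(1)[OF shift_in_S that] in auto)
  show ?thesis
  proof (cases "norm z \<ge> 1")
    case False
    then have zin: "z \<in> ball 0 1 - Z" using z by simp
    have circ: "\<Psi> z (u_shift (axis j h) t) $ i $ k = Y j i k (1 / z) h * exp (xi z (t k))"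
      if "norm z = 1" "h \<in> ball 0 r" for z h
    proof -
      have "norm z \<ge> 1" "z \<noteq> 0" using that by auto
      then show ?thesis
        using \<Psi>(1)[OF shift_in_S[OF that(2)]] by (simp add: baker_matrix_shift)
    qed
    show ?thesis
    proof (rule has_field_derivative_continuation[where f = "\<lambda>z h. \<Psi> z (u_shift (axis j h) t) $ i $ k"
          and e = "\<lambda>z. \<Psi> z t $ j $ k", OF Z r \<Psi>(2-4)[OF shift_in_S] \<Psi>(2-4)[OF t] _ _ _ zin])
      have "continuous_on (sphere 0 1 \<times> ball 0 r) (\<lambda>x::complex \<times> complex. (1 / fst x, snd x))"
        by (intro continuous_on_Pair continuous_on_divide continuous_on_const continuous_on_fst
            continuous_on_snd continuous_on_id) auto
      then have "continuous_on (sphere 0 1 \<times> ball 0 r)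
          (\<lambda>x. (\<lambda>x. Y j i k (fst x) (snd x)) (1 / fst x, snd x))"
        by (rule continuous_on_compose2[OF Y_cont(1)]) (auto simp: norm_divide)
      moreover have "continuous_on (sphere 0 1 \<times> ball (0::complex) r) (\<lambda>x. exp (xi (fst x) (t k)))"
        by (intro continuous_on_exp continuous_on_compose2[OF continuous_on_xi[of "t k" UNIV]]
            summable_xi[OF t] continuous_on_fst continuous_on_id) auto
      ultimately have "continuous_on (sphere 0 1 \<times> ball 0 r)
          (\<lambda>x. Y j i k (1 / fst x) (snd x) * exp (xi (fst x) (t k)))"
        unfolding fst_conv snd_conv by (rule continuous_on_mult)
      then show "continuous_on (sphere 0 1 \<times> ball 0 r) (\<lambda>(z, h). \<Psi> z (u_shift (axis j h) t) $ i $ k)"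
        by (rule continuous_on_eq) (auto simp: circ)
    next
      fix z :: complex assume z: "norm z = 1"
      then have "norm (1 / z) = 1" by (simp add: norm_divide)
      then have "(\<lambda>h. Y j i k (1 / z) h * exp (xi z (t k))) holomorphic_on ball 0 r"
        by (intro holomorphic_on_mult Y_hol holomorphic_on_const)
      then show "(\<lambda>h. \<Psi> z (u_shift (axis j h) t) $ i $ k) holomorphic_on ball 0 r"
        by (rule holomorphic_transform) (simp add: circ z)
      show "deriv (\<lambda>h. \<Psi> z (u_shift (axis j h) t) $ i $ k) 0 = b i j * \<Psi> z t $ j $ k"
        using z by (intro DERIV_imp_deriv outer) simp
    qed
  qed (rule outer)
qed

end

theorem theorem1:
  fixes S :: "('n::finite bkp_times) set"
    and \<tau>0 :: "'n bkp_times \<Rightarrow> complex"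
    and \<tau> :: "'n \<Rightarrow> 'n \<Rightarrow> 'n bkp_times \<Rightarrow> complex"
    and \<beta> :: "'n bkp_times \<Rightarrow> complex ^ 'n ^ 'n"
    and \<Psi> :: "complex \<Rightarrow> 'n bkp_times \<Rightarrow> complex ^ 'n ^ 'n"
    and G :: "'n bkp_times \<Rightarrow> complex ^ 'n ^ 'n"
    and Z :: "complex set"
  assumes suitable: "suitable_times S \<tau>"
    and tau: "bkp_tau_functions S \<tau>0 \<tau>"
    and inv: "\<forall>t\<in>S. invertible (tau_matrix \<tau> t)"
    and beta: "beta_coefficient S \<tau> \<beta>"
    and mero: "baker_meromorphic_inside S \<tau> Z \<Psi>"
    and G: "\<forall>t. G t = \<Psi> 0 t"
  shows
    "(\<forall>t\<in>S. \<forall>z. z \<notin> Z \<longrightarrow> (\<forall>i j. i \<noteq> j \<longrightarrow>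
        u_differentiable_vec j (\<lambda>t. row i (\<Psi> z t)) t \<and>
        u_deriv_vec j (\<lambda>t. row i (\<Psi> z t)) t - \<beta> t $ i $ j *s row j (\<Psi> z t) = 0)) \<and>

     (admissible_G S \<tau> G \<longrightarrow>
       (\<forall>t\<in>S. \<forall>i j. i \<noteq> j \<longrightarrow>
          u_differentiable_vec j (\<lambda>t. row i (G t)) t \<and>
          u_deriv_vec j (\<lambda>t. row i (G t)) t - \<beta> t $ i $ j *s row j (G t) = 0) \<and>
       (\<forall>t\<in>S. \<forall>i.
          u_differentiable_vec i (\<lambda>t. row i (G t)) t \<and>
          u_deriv_vec i (\<lambda>t. row i (G t)) t
            + (\<Sum>k\<in>UNIV - {i}. \<beta> t $ k $ i *s row k (G t)) = 0)) \<and>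

     (\<forall>t\<in>S. \<forall>i j k. i \<noteq> j \<and> j \<noteq> k \<and> i \<noteq> k \<longrightarrow>
        u_differentiable k (\<lambda>t. \<beta> t $ i $ j) t \<and>
        u_deriv k (\<lambda>t. \<beta> t $ i $ j) t - \<beta> t $ i $ k * \<beta> t $ k $ j = 0) \<and>
     (\<forall>t\<in>S. \<forall>i j. i \<noteq> j \<longrightarrow>
        u_differentiable i (\<lambda>t. \<beta> t $ i $ j) t \<and>
        u_differentiable j (\<lambda>t. \<beta> t $ j $ i) t \<and>
        u_deriv i (\<lambda>t. \<beta> t $ i $ j) t + u_deriv j (\<lambda>t. \<beta> t $ j $ i) t
          + (\<Sum>k\<in>UNIV - {i, j}. \<beta> t $ k $ i * \<beta> t $ k $ j) = 0)"
proof -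
  interpret bkp S \<tau>0 \<tau>
    by unfold_locales (fact suitable tau inv)+
  show ?thesis
  proof (intro conjI impI ballI allI)
    fix t z i j assume t: "t \<in> S" and z: "z \<notin> Z" and ij: "(i::'n) \<noteq> j"
    obtain r where "bkp_slice S \<tau>0 \<tau> t r" by (rule slice_exists[OF t])
    then interpret bkp_slice S \<tau>0 \<tau> t r .
    have "((\<lambda>h. row i (\<Psi> z (u_shift (axis j h) t)) $ l) has_field_derivative
        (\<beta> t $ i $ j *s row j (\<Psi> z t)) $ l) (at 0)" for l
      using continued_baker_has_field_derivative[OF mero z ij, of l]
      by (simp add: row_def beta_eq_b[OF beta])
    note u_deriv_vec_eqI[of "\<lambda>t. row i (\<Psi> z t)", OF this]
    then show "u_differentiable_vec j (\<lambda>t. row i (\<Psi> z t)) t"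
      "u_deriv_vec j (\<lambda>t. row i (\<Psi> z t)) t - \<beta> t $ i $ j *s row j (\<Psi> z t) = 0"
      by simp_all
  next
    fix t i j assume adm: "admissible_G S \<tau> G" and t: "t \<in> S" and ij: "(i::'n) \<noteq> j"
    obtain r where "bkp_slice S \<tau>0 \<tau> t r" by (rule slice_exists[OF t])
    then interpret bkp_slice S \<tau>0 \<tau> t r .
    have "((\<lambda>h. row i (G (u_shift (axis j h) t)) $ l) has_field_derivative
        (\<beta> t $ i $ j *s row j (G t)) $ l) (at 0)" for l
      using G_off_diagonal[OF adm ij, of l] by (simp add: row_def beta_eq_b[OF beta])
    note u_deriv_vec_eqI[of "\<lambda>t. row i (G t)", OF this]
    then show "u_differentiable_vec j (\<lambda>t. row i (G t)) t"
      "u_deriv_vec j (\<lambda>t. row i (G t)) t - \<beta> t $ i $ j *s row j (G t) = 0"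
      by simp_all
  next
    fix t i assume adm: "admissible_G S \<tau> G" and t: "t \<in> S"
    obtain r where "bkp_slice S \<tau>0 \<tau> t r" by (rule slice_exists[OF t])
    then interpret bkp_slice S \<tau>0 \<tau> t r .
    have "((\<lambda>h. row i (G (u_shift (axis i h) t)) $ l) has_field_derivative
        (- (\<Sum>k\<in>UNIV - {i}. \<beta> t $ k $ i *s row k (G t))) $ l) (at 0)" for l
      using G_diagonal[OF adm, of i l] by (simp add: row_def beta_eq_b[OF beta])
    note u_deriv_vec_eqI[of "\<lambda>t. row i (G t)", OF this]
    then show "u_differentiable_vec i (\<lambda>t. row i (G t)) t"
      "u_deriv_vec i (\<lambda>t. row i (G t)) t + (\<Sum>k\<in>UNIV - {i}. \<beta> t $ k $ i *s row k (G t)) = 0"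
      by simp_all
  next
    fix t i j k assume t: "t \<in> S" and ijk: "(i::'n) \<noteq> j \<and> j \<noteq> k \<and> i \<noteq> k"
    obtain r where "bkp_slice S \<tau>0 \<tau> t r" by (rule slice_exists[OF t])
    then interpret bkp_slice S \<tau>0 \<tau> t r .
    note u_deriv_eqI[of "\<lambda>t. \<beta> t $ i $ j", OF beta_has_field_derivative[OF beta]]
    then show "u_differentiable k (\<lambda>t. \<beta> t $ i $ j) t"
      "u_deriv k (\<lambda>t. \<beta> t $ i $ j) t - \<beta> t $ i $ k * \<beta> t $ k $ j = 0"
      using ijk by (simp_all add: Lame_1 beta_eq_b[OF beta])
  next
    fix t i j assume t: "t \<in> S" and ij: "(i::'n) \<noteq> j"
    obtain r where "bkp_slice S \<tau>0 \<tau> t r" by (rule slice_exists[OF t])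
    then interpret bkp_slice S \<tau>0 \<tau> t r .
    note d = u_deriv_eqI[of "\<lambda>t. \<beta> t $ _ $ _", OF beta_has_field_derivative[OF beta]]
    show "u_differentiable i (\<lambda>t. \<beta> t $ i $ j) t" "u_differentiable j (\<lambda>t. \<beta> t $ j $ i) t"
      by (rule d(1))+
    show "u_deriv i (\<lambda>t. \<beta> t $ i $ j) t + u_deriv j (\<lambda>t. \<beta> t $ j $ i) t
          + (\<Sum>k\<in>UNIV - {i, j}. \<beta> t $ k $ i * \<beta> t $ k $ j) = 0"
      using Lame_2[OF ij] by (simp add: d(2) beta_eq_b[OF beta])
  qed
qed

end
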